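(* Let $\mathcal{G}$ be an open-ended strongly locally finite graph. Then its skeleton $S^{\mathcal{G}}$ is a bi-embeddability basis of $\mathcal{G}$; that is, $S^{\mathcal{G}}\approx\mathcal{G}$ and $DgSp_{\approx}(\mathcal{G})=DgSp_{\cong}(S^{\mathcal{G}})$.
   Context: Structures are countable and non-empty; infinite structures have universe $\omega$, and $\deg(\mathcal{B})$ is the Turing degree of the atomic diagram of $\mathcal{B}$. Embeddings of graphs are isomorphisms onto induced subgraphs, written $\hookrightarrow$. $\mathcal{A}\approx\mathcal{B}$ (bi-embeddable) means each of $\mathcal{A},\mathcal{B}$ embeds into the other. $DgSp_{\approx}(\mathcal{A})=\{\deg(\mathcal{B}):\mathcal{B}\approx\mathcal{A}\}$ and $DgSp_{\cong}(\mathcal{A})=\{\deg(\mathcal{B}):\mathcal{B}\cong\mathcal{A}\}$. A single structure $\mathcal{B}$ is a bi-embeddability basis of $\mathcal{A}$ if $\mathcal{B}\approx\mathcal{A}$ and $DgSp_{\cong}(\mathcal{B})=DgSp_{\approx}(\mathcal{A})$. A graph is strongly locally finite if all of its connected components are finite. Let $\langle F_i\rangle_{i\in\omega}$ be a fixed Friedberg enumeration of the finite connected graphs, i.e. a uniformly computable list containing exactly one representative of each isomorphism type, such that $|F_i|$ is computable uniformly in $i$. The trace of $\mathcal{G}$ is $tr(\mathcal{G})=\{i: F_i\hookrightarrow\mathcal{G}\}$. The skeleton $S^{\mathcal{G}}$ of $\mathcal{G}$ is the graph (unique up to isomorphism) that is the disjoint union of the graphs $F_i$, $i\in tr(\mathcal{G})$.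 The components of $\mathcal{G}$ are preordered by embeddability. A component is open if it belongs to an infinite strictly ascending chain $C_0<C_1<C_2<\cdots$ of components of $\mathcal{G}$ in this preorder ($C<D$ meaning $C\hookrightarrow D$ and $D\not\hookrightarrow C$). $\mathcal{G}$ is open-ended if every component of $\mathcal{G}$ is open. *)

theory Defs
  imports Main "HOL-Library.Nat_Bijection" "HOL-Library.Countable_Set"
begin

section \<open>Relative computability and Turing degrees\<close>

text \<open>Least zero of \<open>\<lambda>n. f \<langle>a, n\<rangle>\<close>, undefined if some earlier value is undefined.\<close>

definition minimise :: "(nat \<Rightarrow> nat option) \<Rightarrow> nat \<Rightarrow> nat option" where
  "minimise f a =
     (let P = (\<lambda>n. f (prod_encode (a, n)) = Some 0 \<and>
                   (\<forall>m<n. \<exists>v. f (prod_encode (a, m)) = Some (Suc v)))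
      in if \<exists>n. P n then Some (LEAST n. P n) else None)"

definition prim_recurse :: "(nat \<Rightarrow> nat option) \<Rightarrow> (nat \<Rightarrow> nat option) \<Rightarrow> nat \<Rightarrow> nat option" where
  "prim_recurse f g x =
     (case prod_decode x of (a, n) \<Rightarrow>
        rec_nat (f a) (\<lambda>k r. Option.bind r (\<lambda>v. g (prod_encode (a, prod_encode (k, v))))) n)"

text \<open>The partial functions that are recursive relative to the total function \<open>h\<close>.  These are Kleene's
  schemata (basic functions, composition, primitive recursion, minimisation), presented for unary
  functions: a tuple of arguments is a single number, by means of the Cantor pairing
  \<^const>\<open>prod_encode\<close>, whose projections and whose action on functions are taken as
  initial functions and as a closure condition.\<close>

inductive partrec_in :: "(nat \<Rightarrow> nat) \<Rightarrow> (nat \<Rightarrow> nat option) \<Rightarrow> bool" for h where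
  query: "partrec_in h (\<lambda>x. Some (h x))"
| zero: "partrec_in h (\<lambda>x. Some 0)"
| succ: "partrec_in h (\<lambda>x. Some (Suc x))"
| left: "partrec_in h (\<lambda>x. Some (fst (prod_decode x)))"
| right: "partrec_in h (\<lambda>x. Some (snd (prod_decode x)))"
| pair: "partrec_in h f \<Longrightarrow> partrec_in h g \<Longrightarrow>
    partrec_in h (\<lambda>x. Option.bind (f x) (\<lambda>a. Option.bind (g x) (\<lambda>b. Some (prod_encode (a, b)))))"
| comp: "partrec_in h f \<Longrightarrow> partrec_in h g \<Longrightarrow> partrec_in h (\<lambda>x. Option.bind (g x) f)"
| prim_rec: "partrec_in h f \<Longrightarrow> partrec_in h g \<Longrightarrow> partrec_in h (prim_recurse f g)"
| minim: "partrec_in h f \<Longrightarrow> partrec_in h (minimise f)"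

definition computable_fun :: "(nat \<Rightarrow> nat) \<Rightarrow> bool" where
  "computable_fun f \<longleftrightarrow> partrec_in (\<lambda>_. 0) (\<lambda>x. Some (f x))"

definition char_fun :: "nat set \<Rightarrow> nat \<Rightarrow> nat" where
  "char_fun A x = (if x \<in> A then 1 else 0)"

definition computable_set :: "nat set \<Rightarrow> bool" where
  "computable_set A \<longleftrightarrow> computable_fun (char_fun A)"

definition turing_reducible :: "nat set \<Rightarrow> nat set \<Rightarrow> bool" (infix "\<le>\<^sub>T" 50) where
  "A \<le>\<^sub>T B \<longleftrightarrow> partrec_in (char_fun B) (\<lambda>x. Some (char_fun A x))"

definition turing_degree :: "nat set \<Rightarrow> nat set set" where
  "turing_degree A = {B. B \<le>\<^sub>T A \<and> A \<le>\<^sub>T B}"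


section \<open>Graphs and embeddings\<close>

record 'a ugraph =
  verts :: "'a set"
  edges :: "('a \<times> 'a) set"

definition simple_ugraph :: "'a ugraph \<Rightarrow> bool" where
  "simple_ugraph G \<longleftrightarrow>
     verts G \<noteq> {} \<and> edges G \<subseteq> verts G \<times> verts G \<and> sym (edges G) \<and> irrefl (edges G)"

text \<open>Finite graphs may have any finite non-empty set of natural numbers as their universe.\<close>

definition omega_ugraph :: "nat ugraph \<Rightarrow> bool" where
  "omega_ugraph G \<longleftrightarrow> simple_ugraph G \<and> (infinite (verts G) \<longrightarrow> verts G = UNIV)"

definition induced_on :: "'a ugraph \<Rightarrow> 'a set \<Rightarrow> 'a ugraph" where
  "induced_on G X = \<lparr>verts = X, edges = edges G \<inter> X \<times> X\<rparr>"

definition isomorphism :: "('a \<Rightarrow> 'b) \<Rightarrow> 'a ugraph \<Rightarrow> 'b ugraph \<Rightarrow> bool" where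
  "isomorphism f G H \<longleftrightarrow> bij_betw f (verts G) (verts H) \<and>
     (\<forall>u\<in>verts G. \<forall>v\<in>verts G. (u, v) \<in> edges G \<longleftrightarrow> (f u, f v) \<in> edges H)"

definition embedding :: "('a \<Rightarrow> 'b) \<Rightarrow> 'a ugraph \<Rightarrow> 'b ugraph \<Rightarrow> bool" where
  "embedding f G H \<longleftrightarrow>
     f ` verts G \<subseteq> verts H \<and> isomorphism f G (induced_on H (f ` verts G))"

definition isomorphic :: "'a ugraph \<Rightarrow> 'b ugraph \<Rightarrow> bool" (infix "\<cong>\<^sub>G" 50) where
  "G \<cong>\<^sub>G H \<longleftrightarrow> (\<exists>f. isomorphism f G H)"

definition embeds :: "'a ugraph \<Rightarrow> 'b ugraph \<Rightarrow> bool" (infix "\<hookrightarrow>\<^sub>G" 50) where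
  "G \<hookrightarrow>\<^sub>G H \<longleftrightarrow> (\<exists>f. embedding f G H)"

definition bi_embeddable :: "'a ugraph \<Rightarrow> 'b ugraph \<Rightarrow> bool" (infix "\<approx>\<^sub>G" 50) where
  "G \<approx>\<^sub>G H \<longleftrightarrow> G \<hookrightarrow>\<^sub>G H \<and> H \<hookrightarrow>\<^sub>G G"


section \<open>Degree spectra\<close>

text \<open>Atomic and negated atomic sentences in the language of graphs with equality, with a constant
  for each natural number, and their Goedel numbers.\<close>

datatype graph_lit = EqL nat nat | NeqL nat nat | AdjL nat nat | NadjL nat nat

fun lit_code :: "graph_lit \<Rightarrow> nat" where
  "lit_code (EqL u v) = prod_encode (0, prod_encode (u, v))"
| "lit_code (NeqL u v) = prod_encode (1, prod_encode (u, v))"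
| "lit_code (AdjL u v) = prod_encode (2, prod_encode (u, v))"
| "lit_code (NadjL u v) = prod_encode (3, prod_encode (u, v))"

text \<open>Constants that do not name an element of the graph do not belong to its language, so no
  literal mentioning them is in the diagram.\<close>

fun in_diagram :: "nat ugraph \<Rightarrow> graph_lit \<Rightarrow> bool" where
  "in_diagram G (EqL u v) \<longleftrightarrow> u \<in> verts G \<and> v \<in> verts G \<and> u = v"
| "in_diagram G (NeqL u v) \<longleftrightarrow> u \<in> verts G \<and> v \<in> verts G \<and> u \<noteq> v"
| "in_diagram G (AdjL u v) \<longleftrightarrow> u \<in> verts G \<and> v \<in> verts G \<and> (u, v) \<in> edges G"
| "in_diagram G (NadjL u v) \<longleftrightarrow> u \<in> verts G \<and> v \<in> verts G \<and> (u, v) \<notin> edges G"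

definition atomic_diagram :: "nat ugraph \<Rightarrow> nat set" where
  "atomic_diagram G = lit_code ` {l. in_diagram G l}"

definition deg :: "nat ugraph \<Rightarrow> nat set set" where
  "deg G = turing_degree (atomic_diagram G)"

definition DgSp_iso :: "nat ugraph \<Rightarrow> nat set set set" where
  "DgSp_iso A = {deg B | B. omega_ugraph B \<and> B \<cong>\<^sub>G A}"

definition DgSp_biemb :: "nat ugraph \<Rightarrow> nat set set set" where
  "DgSp_biemb A = {deg B | B. omega_ugraph B \<and> B \<approx>\<^sub>G A}"

definition bi_embeddability_basis :: "nat ugraph \<Rightarrow> nat ugraph \<Rightarrow> bool" where
  "bi_embeddability_basis B A \<longleftrightarrow>
     omega_ugraph B \<and> B \<approx>\<^sub>G A \<and> DgSp_iso B = DgSp_biemb A"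


section \<open>Components, traces and skeletons\<close>

definition ugraph_connected :: "'a ugraph \<Rightarrow> bool" where
  "ugraph_connected G \<longleftrightarrow> (\<forall>u\<in>verts G. \<forall>v\<in>verts G. (u, v) \<in> (edges G)\<^sup>*)"

definition ugraph_components :: "'a ugraph \<Rightarrow> 'a ugraph set" where
  "ugraph_components G = (\<lambda>v. induced_on G {w. (v, w) \<in> (edges G)\<^sup>*}) ` verts G"

definition strongly_locally_finite :: "'a ugraph \<Rightarrow> bool" where
  "strongly_locally_finite G \<longleftrightarrow> (\<forall>C\<in>ugraph_components G. finite (verts C))"

definition strictly_embeds :: "'a ugraph \<Rightarrow> 'b ugraph \<Rightarrow> bool" (infix "<\<^sub>G" 50) where
  "C <\<^sub>G D \<longleftrightarrow> C \<hookrightarrow>\<^sub>G D \<and> \<not> D \<hookrightarrow>\<^sub>G C"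

definition open_component :: "'a ugraph \<Rightarrow> 'a ugraph \<Rightarrow> bool" where
  "open_component G C \<longleftrightarrow> C \<in> ugraph_components G \<and>
     (\<exists>c :: nat \<Rightarrow> 'a ugraph. (\<forall>n. c n \<in> ugraph_components G) \<and>
        (\<forall>n. c n <\<^sub>G c (Suc n)) \<and> (\<exists>n. c n = C))"

definition open_ended :: "'a ugraph \<Rightarrow> bool" where
  "open_ended G \<longleftrightarrow> (\<forall>C\<in>ugraph_components G. open_component G C)"

definition friedberg_enumeration :: "(nat \<Rightarrow> nat ugraph) \<Rightarrow> bool" where
  "friedberg_enumeration F \<longleftrightarrow>
     (\<forall>i. omega_ugraph (F i) \<and> finite (verts (F i)) \<and> ugraph_connected (F i)) \<and>
     (\<forall>C :: nat ugraph. simple_ugraph C \<and> finite (verts C) \<and> ugraph_connected C \<longrightarrow>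
        (\<exists>!i. C \<cong>\<^sub>G F i)) \<and>
     computable_set {prod_encode (i, l) | i l. l \<in> atomic_diagram (F i)} \<and>
     computable_fun (\<lambda>i. card (verts (F i)))"

definition ugraph_trace :: "(nat \<Rightarrow> nat ugraph) \<Rightarrow> 'a ugraph \<Rightarrow> nat set" where
  "ugraph_trace F G = {i. F i \<hookrightarrow>\<^sub>G G}"

definition disjoint_union :: "'i set \<Rightarrow> ('i \<Rightarrow> 'a ugraph) \<Rightarrow> ('i \<times> 'a) ugraph" where
  "disjoint_union I F =
     \<lparr>verts = (SIGMA i:I. verts (F i)),
      edges = {((i, u), (i, v)) | i u v. i \<in> I \<and> (u, v) \<in> edges (F i)}\<rparr>"

text \<open>The skeleton is determined up to isomorphism; this is the predicate of being one of its
  copies.  The lemmas \<open>skeleton_exists\<close> and \<open>skeleton_unique\<close> below justify it.\<close>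

definition is_skeleton :: "(nat \<Rightarrow> nat ugraph) \<Rightarrow> nat ugraph \<Rightarrow> nat ugraph \<Rightarrow> bool" where
  "is_skeleton F G S \<longleftrightarrow> omega_ugraph S \<and> S \<cong>\<^sub>G disjoint_union (ugraph_trace F G) F"

lemma isomorphic_sym: "G \<cong>\<^sub>G H \<Longrightarrow> H \<cong>\<^sub>G G"
proof -
  assume "G \<cong>\<^sub>G H"
  then obtain f where f: "isomorphism f G H"
    unfolding isomorphic_def by blast
  let ?g = "the_inv_into (verts G) f"
  have b: "bij_betw f (verts G) (verts H)" and inj: "inj_on f (verts G)"
    using f unfolding isomorphism_def bij_betw_def by auto
  have "?g x \<in> verts G \<and> f (?g x) = x" if "x \<in> verts H" for x
    using b that by (metis bij_betw_def f_the_inv_into_f order_refl the_inv_into_into)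
  then have "isomorphism ?g H G"
    using f bij_betw_the_inv_into[OF b] unfolding isomorphism_def by metis
  then show ?thesis
    unfolding isomorphic_def by blast
qed

lemma isomorphic_trans: "G \<cong>\<^sub>G H \<Longrightarrow> H \<cong>\<^sub>G K \<Longrightarrow> G \<cong>\<^sub>G K"
proof -
  assume "G \<cong>\<^sub>G H" "H \<cong>\<^sub>G K"
  then obtain f g where f: "isomorphism f G H" and g: "isomorphism g H K"
    unfolding isomorphic_def by blast
  have "f u \<in> verts H" if "u \<in> verts G" for u
    using f that unfolding isomorphism_def by (meson bij_betwE)
  then have "isomorphism (g \<circ> f) G K"
    using f g unfolding isomorphism_def by (auto intro: bij_betw_trans)
  then show ?thesis
    unfolding isomorphic_def by blast
qed

lemma omega_copy_exists:
  fixes H :: "'a :: countable ugraph"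
  assumes "simple_ugraph H"
  shows "\<exists>S. omega_ugraph S \<and> S \<cong>\<^sub>G H"
proof -
  let ?t = "to_nat_on (verts H)"
  define S where "S = \<lparr>verts = ?t ` verts H, edges = map_prod ?t ?t ` edges H\<rparr>"
  have E: "edges H \<subseteq> verts H \<times> verts H" and ne: "verts H \<noteq> {}"
    and sym: "sym (edges H)" and irr: "irrefl (edges H)"
    using assms unfolding simple_ugraph_def by auto
  have inj: "inj_on ?t (verts H)"
    by (rule inj_on_to_nat_on) simp
  have edge: "(u, v) \<in> edges H \<longleftrightarrow> (?t u, ?t v) \<in> edges S"
    if "u \<in> verts H" "v \<in> verts H" for u v
  proof
    assume "(?t u, ?t v) \<in> edges S"
    then obtain u' v' where *: "(u', v') \<in> edges H" "?t u' = ?t u" "?t v' = ?t v"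
      unfolding S_def by auto
    moreover have "u' \<in> verts H" "v' \<in> verts H"
      using * E by auto
    ultimately show "(u, v) \<in> edges H"
      using that inj_onD[OF inj] by metis
  qed (auto simp: S_def intro: image_eqI[where x = "(u, v)"])
  have "isomorphism ?t H S"
    using edge inj unfolding isomorphism_def bij_betw_def by (simp add: S_def)
  then have "S \<cong>\<^sub>G H"
    using isomorphic_sym unfolding isomorphic_def by blast
  moreover have "simple_ugraph S"
    unfolding simple_ugraph_def
  proof (intro conjI)
    show "verts S \<noteq> {}" using ne by (simp add: S_def)
    show "edges S \<subseteq> verts S \<times> verts S" using E by (auto simp: S_def)
    show "sym (edges S)" using sym unfolding S_def sym_def by force
    show "irrefl (edges S)"
    proof (rule irreflI)
      fix x
      show "(x, x) \<notin> edges S"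
      proof
        assume x: "(x, x) \<in> edges S"
        then obtain u where "u \<in> verts H" "x = ?t u" using E by (auto simp: S_def)
        then show False using edge[of u u] x irr by (auto simp: irrefl_def)
      qed
    qed
  qed
  moreover have "verts S = UNIV" if "infinite (verts S)"
  proof -
    have "infinite (verts H)" using that by (auto simp: S_def)
    then show ?thesis
      using to_nat_on_infinite[of "verts H"] by (simp add: S_def bij_betw_def)
  qed
  ultimately show ?thesis
    unfolding omega_ugraph_def by blast
qed

lemma component_simple_connected:
  assumes "simple_ugraph G" "v \<in> verts G"
  defines "C \<equiv> induced_on G {w. (v, w) \<in> (edges G)\<^sup>*}"
  shows "simple_ugraph C" "ugraph_connected C" "verts C \<subseteq> verts G"
proof -
  have E: "edges G \<subseteq> verts G \<times> verts G" and sym: "sym (edges G)" and irr: "irrefl (edges G)"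
    using assms(1) unfolding simple_ugraph_def by auto
  show "simple_ugraph C"
    using sym irr unfolding simple_ugraph_def C_def induced_on_def sym_def irrefl_def by auto
  have "w \<in> verts G" if "(v, w) \<in> (edges G)\<^sup>*" for w
    using that by (induction rule: rtrancl_induct) (use assms(2) E in auto)
  then show "verts C \<subseteq> verts G"
    by (auto simp: C_def induced_on_def)
  have symC: "sym ((edges C)\<^sup>*)"
    by (rule sym_rtrancl) (use sym in \<open>auto simp: sym_def C_def induced_on_def\<close>)
  have *: "(v, w) \<in> (edges C)\<^sup>*" if "(v, w) \<in> (edges G)\<^sup>*" for w
    using that
  proof (induction rule: rtrancl_induct)
    case (step y z)
    then have "(y, z) \<in> edges C"
      by (auto simp: C_def induced_on_def)
    with step.IH show ?case by simp
  qed simp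
  show "ugraph_connected C"
    unfolding ugraph_connected_def
  proof (intro ballI)
    fix u w assume "u \<in> verts C" "w \<in> verts C"
    then have "(v, u) \<in> (edges C)\<^sup>*" "(v, w) \<in> (edges C)\<^sup>*"
      using * by (auto simp: C_def induced_on_def)
    then show "(u, w) \<in> (edges C)\<^sup>*"
      using symC by (meson rtrancl_trans symE)
  qed
qed

lemma skeleton_exists:
  assumes F: "friedberg_enumeration F" and G: "omega_ugraph G" "strongly_locally_finite G"
  shows "\<exists>S. is_skeleton F G S"
proof -
  have simpG: "simple_ugraph G" using G(1) by (simp add: omega_ugraph_def)
  then obtain v where v: "v \<in> verts G" by (auto simp: simple_ugraph_def)
  define C where "C = induced_on G {w. (v, w) \<in> (edges G)\<^sup>*}"
  note C = component_simple_connected[OF simpG v, folded C_def]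
  have "finite (verts C)"
    using G(2) v by (auto simp: strongly_locally_finite_def ugraph_components_def C_def)
  then obtain i where "C \<cong>\<^sub>G F i"
    using F C unfolding friedberg_enumeration_def by blast
  then obtain f where f: "isomorphism f (F i) C"
    using isomorphic_sym unfolding isomorphic_def by blast
  then have "f ` verts (F i) = verts C"
    by (simp add: isomorphism_def bij_betw_def)
  moreover have "induced_on G (verts C) = C"
    by (simp add: C_def induced_on_def)
  ultimately have "embedding f (F i) G"
    using f C(3) unfolding embedding_def by simp
  then have i: "i \<in> ugraph_trace F G"
    by (auto simp: ugraph_trace_def embeds_def)
  have Fs: "simple_ugraph (F i)" for i
    using F by (auto simp: friedberg_enumeration_def omega_ugraph_def)
  have "simple_ugraph (disjoint_union (ugraph_trace F G) F)"
    unfolding simple_ugraph_def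
  proof (intro conjI)
    show "verts (disjoint_union (ugraph_trace F G) F) \<noteq> {}"
      using i Fs[of i] unfolding disjoint_union_def simple_ugraph_def by auto
    show "sym (edges (disjoint_union (ugraph_trace F G) F))"
      using Fs unfolding disjoint_union_def simple_ugraph_def sym_def by fastforce
    show "irrefl (edges (disjoint_union (ugraph_trace F G) F))"
      using Fs unfolding disjoint_union_def simple_ugraph_def irrefl_def by fastforce
    show "edges (disjoint_union (ugraph_trace F G) F)
        \<subseteq> verts (disjoint_union (ugraph_trace F G) F) \<times> verts (disjoint_union (ugraph_trace F G) F)"
      using Fs unfolding disjoint_union_def simple_ugraph_def by fastforce
  qed
  then show ?thesis
    unfolding is_skeleton_def by (rule omega_copy_exists)
qed

lemma skeleton_unique: "is_skeleton F G S \<Longrightarrow> is_skeleton F G S' \<Longrightarrow> S \<cong>\<^sub>G S'"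
  unfolding is_skeleton_def by (blast intro: isomorphic_sym isomorphic_trans)

end

(* Every component of G embeds into infinitely many other components and into infinitely many
   members of the trace, so components can be matched injectively in both directions, which gives
   S ~ G.  Conversely, let B ~ G.  Then B has the trace of G, and this trace is enumerable from the
   diagram of B, since an embedding of a finite graph is a finite search.  Hence so is the vertex set
   V of the disjoint union of the F_i with i in the trace.  Every cofinite subset of V contains
   an adjacent and a non-adjacent pair, so a greedy construction yields a B-computable
   bijection p from the natural numbers onto V such that p (3n) and p (3n + 1) are adjacent iff n is
   in the diagram of B.  The pullback of the union along p is a copy of S of the same degree as B. *)

theory Submission
  imports Defs
begin

section \<open>Relative computability of total functions and predicates\<close>

abbreviation pfst :: "nat \<Rightarrow> nat" where "pfst x \<equiv> fst (prod_decode x)"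
abbreviation psnd :: "nat \<Rightarrow> nat" where "psnd x \<equiv> snd (prod_decode x)"

definition rec_in :: "(nat \<Rightarrow> nat) \<Rightarrow> (nat \<Rightarrow> nat) \<Rightarrow> bool" where
  "rec_in h f \<longleftrightarrow> partrec_in h (\<lambda>x. Some (f x))"

definition dec_in :: "(nat \<Rightarrow> nat) \<Rightarrow> (nat \<Rightarrow> bool) \<Rightarrow> bool" where
  "dec_in h P \<longleftrightarrow> rec_in h (\<lambda>x. of_bool (P x))"

text \<open>Only the \<open>query\<close> clause mentions the oracle, and there the computation of
  \<open>h\<close> from \<open>g\<close> is substituted; every other schema carries over
  verbatim.\<close>

lemma partrec_in_trans:
  assumes "partrec_in h f" "rec_in g h"
  shows "partrec_in g f"
  using assms(1)
proof induction
  case query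
  show ?case using assms(2) by (simp add: rec_in_def)
qed (intro partrec_in.intros; assumption)+

lemma rec_in_trans: "rec_in h f \<Longrightarrow> rec_in g h \<Longrightarrow> rec_in g f"
  unfolding rec_in_def[of h f] rec_in_def[of g f] by (rule partrec_in_trans)

lemma rec_in_oracle: "rec_in h h"
  unfolding rec_in_def by (rule partrec_in.query)

lemma rec_in_comp:
  assumes "rec_in h f" "rec_in h g"
  shows "rec_in h (\<lambda>x. f (g x))"
  using partrec_in.comp[OF assms[unfolded rec_in_def]] by (simp add: rec_in_def)

lemma dec_in_comp:
  assumes "dec_in h P" "rec_in h g"
  shows "dec_in h (\<lambda>x. P (g x))"
  using assms rec_in_comp[of h "\<lambda>x. of_bool (P x)" g] by (simp add: dec_in_def)

lemma rec_in_Suc: "rec_in h f \<Longrightarrow> rec_in h (\<lambda>x. Suc (f x))"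
  using rec_in_comp[of h Suc f] partrec_in.succ by (simp add: rec_in_def)

lemma rec_in_pfst: "rec_in h f \<Longrightarrow> rec_in h (\<lambda>x. pfst (f x))"
  using rec_in_comp[of h pfst f] partrec_in.left by (simp add: rec_in_def)

lemma rec_in_psnd: "rec_in h f \<Longrightarrow> rec_in h (\<lambda>x. psnd (f x))"
  using rec_in_comp[of h psnd f] partrec_in.right by (simp add: rec_in_def)

lemma rec_in_pair:
  assumes "rec_in h f" "rec_in h g"
  shows "rec_in h (\<lambda>x. prod_encode (f x, g x))"
  using partrec_in.pair[OF assms[unfolded rec_in_def]] by (simp add: rec_in_def)

lemma rec_in_const: "rec_in h (\<lambda>x. c)"
proof (induction c)
  case 0
  show ?case using partrec_in.zero by (simp add: rec_in_def)
qed (rule rec_in_Suc)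

lemma rec_in_id: "rec_in h (\<lambda>x. x)"
proof -
  have "rec_in h pfst" "rec_in h psnd"
    using partrec_in.left partrec_in.right by (simp_all add: rec_in_def)
  from rec_in_pair[OF this] show ?thesis by simp
qed

section \<open>Primitive recursion, arithmetic, bounded quantifiers and unbounded search\<close>

text \<open>Translates the unary schema \<open>prim_recurse\<close> into \<open>rec_nat\<close>. The
  step function receives the parameter, the counter and the previous value as one number
  \<open><x, <k, r>>\<close>, hence the projections in the second hypothesis.\<close>

lemma rec_in_rec_nat:
  assumes f: "rec_in h f"
    and g: "rec_in h (\<lambda>z. g (pfst z) (pfst (psnd z)) (psnd (psnd z)))"
    and n: "rec_in h n"
  shows "rec_in h (\<lambda>x. rec_nat (f x) (g x) (n x))"
proof -
  let ?f = "\<lambda>x. Some (f x)"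
  let ?g = "\<lambda>z. Some (g (pfst z) (pfst (psnd z)) (psnd (psnd z)))"
  have "rec_nat (?f a) (\<lambda>k r. Option.bind r (\<lambda>v. ?g (prod_encode (a, prod_encode (k, v))))) m
      = Some (rec_nat (f a) (g a) m)" for a m
    by (induction m) auto
  then have "prim_recurse ?f ?g = (\<lambda>z. Some (rec_nat (f (pfst z)) (g (pfst z)) (psnd z)))"
    by (auto simp: prim_recurse_def fun_eq_iff split: prod.split)
  then have "rec_in h (\<lambda>z. rec_nat (f (pfst z)) (g (pfst z)) (psnd z))"
    using partrec_in.prim_rec[of h ?f ?g] f g by (simp add: rec_in_def)
  from rec_in_comp[OF this rec_in_pair[OF rec_in_id n]] show ?thesis by simp
qed

lemma rec_in_add: "rec_in h f \<Longrightarrow> rec_in h g \<Longrightarrow> rec_in h (\<lambda>x. f x + g x)"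
proof -
  assume *: "rec_in h f" "rec_in h g"
  have "rec_in h (\<lambda>x. rec_nat (f x) (\<lambda>_ r. Suc r) (g x))"
    by (intro rec_in_rec_nat rec_in_Suc rec_in_psnd rec_in_id *)
  moreover have "rec_nat a (\<lambda>_ r. Suc r) b = a + b" for a b :: nat
    by (induction b) auto
  ultimately show ?thesis by simp
qed

lemma rec_in_mult: "rec_in h f \<Longrightarrow> rec_in h g \<Longrightarrow> rec_in h (\<lambda>x. f x * g x)"
proof -
  assume *: "rec_in h f" "rec_in h g"
  have "rec_in h (\<lambda>x. rec_nat 0 (\<lambda>_ r. r + f x) (g x))"
    by (intro rec_in_rec_nat rec_in_add rec_in_psnd rec_in_const rec_in_id *
        rec_in_comp[OF *(1) rec_in_pfst])
  moreover have "rec_nat 0 (\<lambda>_ r. r + a) b = a * b" for a b :: nat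
    by (induction b) auto
  ultimately show ?thesis by simp
qed

lemma rec_in_diff: "rec_in h f \<Longrightarrow> rec_in h g \<Longrightarrow> rec_in h (\<lambda>x. f x - g x)"
proof -
  assume *: "rec_in h f" "rec_in h g"
  \<comment> \<open>The predecessor is a recursion that returns its counter; truncated subtraction
    iterates it.\<close>
  have "rec_nat 0 (\<lambda>k _. k) n = n - 1" for n
    by (induction n) auto
  moreover have "rec_in h (\<lambda>x. rec_nat (f x) (\<lambda>_ r. rec_nat 0 (\<lambda>k _. k) r) (g x))"
    by (intro rec_in_rec_nat rec_in_psnd rec_in_pfst rec_in_const rec_in_id *)
  moreover have "rec_nat a (\<lambda>_ r. r - 1) b = a - b" for a b :: nat
    by (induction b) auto
  ultimately show ?thesis by simp
qed

lemma dec_in_less: "rec_in h f \<Longrightarrow> rec_in h g \<Longrightarrow> dec_in h (\<lambda>x. f x < g x)"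
proof -
  assume *: "rec_in h f" "rec_in h g"
  \<comment> \<open>With truncated subtraction this is the sign of \<open>g x - f x\<close>.\<close>
  have "rec_in h (\<lambda>x. 1 - (1 - (g x - f x)))"
    by (intro rec_in_diff rec_in_const *)
  moreover have "1 - (1 - (b - a)) = of_bool (a < b)" for a b :: nat
    by auto
  ultimately show ?thesis by (simp add: dec_in_def)
qed

lemma dec_in_not: "dec_in h P \<Longrightarrow> dec_in h (\<lambda>x. \<not> P x)"
proof -
  assume "dec_in h P"
  then have "rec_in h (\<lambda>x. 1 - of_bool (P x))"
    unfolding dec_in_def by (intro rec_in_diff rec_in_const)
  moreover have "1 - of_bool b = (of_bool (\<not> b) :: nat)" for b
    by auto
  ultimately show ?thesis by (simp add: dec_in_def)
qed

lemma dec_in_conj: "dec_in h P \<Longrightarrow> dec_in h Q \<Longrightarrow> dec_in h (\<lambda>x. P x \<and> Q x)"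
  unfolding dec_in_def of_bool_conj by (rule rec_in_mult)

lemma dec_in_disj: "dec_in h P \<Longrightarrow> dec_in h Q \<Longrightarrow> dec_in h (\<lambda>x. P x \<or> Q x)"
  using dec_in_not[OF dec_in_conj[OF dec_in_not dec_in_not, of h P Q]] by simp

lemma dec_in_imp: "dec_in h P \<Longrightarrow> dec_in h Q \<Longrightarrow> dec_in h (\<lambda>x. P x \<longrightarrow> Q x)"
  using dec_in_disj[OF dec_in_not, of h P Q] unfolding imp_conv_disj .

lemma dec_in_iff: "dec_in h P \<Longrightarrow> dec_in h Q \<Longrightarrow> dec_in h (\<lambda>x. P x \<longleftrightarrow> Q x)"
  using dec_in_conj[OF dec_in_imp dec_in_imp, of h P Q Q P] unfolding iff_conv_conj_imp .

lemma dec_in_le: "rec_in h f \<Longrightarrow> rec_in h g \<Longrightarrow> dec_in h (\<lambda>x. f x \<le> g x)"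
  using dec_in_not[OF dec_in_less, of h g f] by (simp add: not_less)

lemma dec_in_eq: "rec_in h f \<Longrightarrow> rec_in h g \<Longrightarrow> dec_in h (\<lambda>x. f x = g x)"
  using dec_in_conj[OF dec_in_le dec_in_le, of h f g g f] unfolding eq_iff[of "f _"] .

lemma rec_in_if:
  assumes "dec_in h P" "rec_in h f" "rec_in h g"
  shows "rec_in h (\<lambda>x. if P x then f x else g x)"
proof -
  have "rec_in h (\<lambda>x. of_bool (P x) * f x + of_bool (\<not> P x) * g x)"
    using assms dec_in_not[OF assms(1)] unfolding dec_in_def
    by (intro rec_in_add rec_in_mult)
  moreover have "of_bool b * s + of_bool (\<not> b) * t = (if b then s else t)" for b and s t :: nat
    by auto
  ultimately show ?thesis by simp
qed

text \<open>The indicator of a bounded universal quantifier is the product of the indicators of its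
  instances, accumulated by primitive recursion.\<close>

lemma dec_in_all_less:
  assumes P: "dec_in h (\<lambda>z. P (pfst z) (psnd z))" and b: "rec_in h b"
  shows "dec_in h (\<lambda>x. \<forall>y<b x. P x y)"
proof -
  have "rec_in h (\<lambda>x. rec_nat 1 (\<lambda>k r. r * of_bool (P x k)) (b x))"
  proof (intro rec_in_rec_nat rec_in_mult rec_in_const rec_in_psnd rec_in_id b)
    have "dec_in h (\<lambda>z. P (pfst (prod_encode (pfst z, pfst (psnd z))))
        (psnd (prod_encode (pfst z, pfst (psnd z)))))"
      by (rule dec_in_comp[OF P]) (intro rec_in_pair rec_in_pfst rec_in_psnd rec_in_id)
    then show "rec_in h (\<lambda>z. of_bool (P (pfst z) (pfst (psnd z))))"
      by (simp add: dec_in_def)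
  qed
  moreover have "rec_nat 1 (\<lambda>k r. r * of_bool (P x k)) n = (of_bool (\<forall>y<n. P x y) :: nat)" for x n
    by (induction n) (auto simp: less_Suc_eq)
  ultimately show ?thesis by (simp add: dec_in_def)
qed

lemma dec_in_ex_less:
  assumes P: "dec_in h (\<lambda>z. P (pfst z) (psnd z))" and b: "rec_in h b"
  shows "dec_in h (\<lambda>x. \<exists>y<b x. P x y)"
  using dec_in_not[OF dec_in_all_less[OF dec_in_not[OF P] b]] by simp

text \<open>\<open>minimise\<close> looks for a zero, so it is applied to the indicator of the
  negation. The existence hypothesis makes the search end for every \<open>x\<close>, so that the
  result is total.\<close>

lemma rec_in_Least:
  assumes P: "dec_in h (\<lambda>z. P (pfst z) (psnd z))" and ex: "\<And>x. \<exists>y. P x y"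
  shows "rec_in h (\<lambda>x. LEAST y. P x y)"
proof -
  let ?f = "\<lambda>z. Some (of_bool (\<not> P (pfst z) (psnd z))) :: nat option"
  have least: "P x (LEAST y. P x y)" for x
    using ex[of x] by (metis LeastI_ex)
  have *: "?f (prod_encode (x, n)) = Some 0 \<and>
      (\<forall>m<n. \<exists>v. ?f (prod_encode (x, m)) = Some (Suc v)) \<longleftrightarrow> n = (LEAST y. P x y)" for x n
  proof -
    have "?f (prod_encode (x, n)) = Some 0 \<and>
        (\<forall>m<n. \<exists>v. ?f (prod_encode (x, m)) = Some (Suc v)) \<longleftrightarrow> P x n \<and> (\<forall>m<n. \<not> P x m)"
      by (auto simp: of_bool_def split: if_splits)
    also have "\<dots> \<longleftrightarrow> n = (LEAST y. P x y)"
      using least[of x] not_less_Least[of _ "P x"] by (metis linorder_neqE_nat)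
    finally show ?thesis .
  qed
  have "minimise ?f = (\<lambda>x. Some (LEAST y. P x y))"
    unfolding minimise_def * Let_def by (auto intro: Least_equality)
  moreover have "partrec_in h ?f"
    using dec_in_not[OF P] by (simp add: dec_in_def rec_in_def)
  ultimately show ?thesis
    using partrec_in.minim[of h ?f] by (simp add: rec_in_def)
qed

lemmas rec_in_intros =
  rec_in_id rec_in_const rec_in_Suc rec_in_pfst rec_in_psnd rec_in_pair rec_in_add rec_in_mult
  rec_in_diff rec_in_if dec_in_less dec_in_le dec_in_eq dec_in_not dec_in_conj dec_in_disj
  dec_in_imp dec_in_iff dec_in_all_less dec_in_ex_less

text \<open>The quotient by a fixed positive \<open>d\<close> is found by search, as the least
  \<open>q\<close> with \<open>z < d * Suc q\<close>.\<close>

lemma rec_in_div: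
  assumes "rec_in h f" "0 < d"
  shows "rec_in h (\<lambda>x. f x div d)"
proof -
  have "rec_in h (\<lambda>z. LEAST q. z < d * Suc q)"
  proof (intro rec_in_Least rec_in_intros)
    show "\<exists>q. z < d * Suc q" for z
      using assms(2) by (intro exI[of _ z]) (cases d; simp)
  qed
  moreover have "(LEAST q. z < d * Suc q) = z div d" for z
  proof (rule Least_equality)
    show "z < d * Suc (z div d)" using assms(2) by (simp add: dividend_less_times_div)
    show "z div d \<le> q" if "z < d * Suc q" for q
      using assms(2) that by (simp add: less_mult_imp_div_less mult.commute less_Suc_eq_le[symmetric])
  qed
  ultimately have "rec_in h (\<lambda>z. z div d)" by simp
  from rec_in_comp[OF this assms(1)] show ?thesis .
qed

lemma rec_in_mod:
  assumes "rec_in h f" "0 < d"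
  shows "rec_in h (\<lambda>x. f x mod d)"
  unfolding modulo_nat_def by (intro rec_in_intros rec_in_div assms)

text \<open>A number \<open>c = \<langle>a\<^sub>0, \<langle>a\<^sub>1, \<langle>a\<^sub>2, \<dots>\<rangle>\<rangle>\<rangle>\<close> is read as the sequence of its entries.\<close>

definition entry :: "nat \<Rightarrow> nat \<Rightarrow> nat" where
  "entry c i = pfst (rec_nat c (\<lambda>_ r. psnd r) i)"

lemma rec_in_entry: "rec_in h f \<Longrightarrow> rec_in h g \<Longrightarrow> rec_in h (\<lambda>x. entry (f x) (g x))"
  unfolding entry_def by (intro rec_in_intros rec_in_rec_nat)

lemma entry_0 [simp]: "entry (prod_encode (y, c)) 0 = y"
  by (simp add: entry_def)

lemma entry_Suc [simp]: "entry (prod_encode (y, c)) (Suc i) = entry c i"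
proof -
  have "rec_nat (prod_encode (y, c)) (\<lambda>_ r. psnd r) (Suc i) = rec_nat c (\<lambda>_ r. psnd r) i"
    by (induction i) auto
  then show ?thesis by (simp add: entry_def)
qed

text \<open>A code carries no length, so only finitely many entries are prescribed; the induction
  puts the first value in front of a code of the rest.\<close>

lemma entry_exists: "\<exists>c. \<forall>i<n. entry c i = f i"
proof (induction n arbitrary: f)
  case (Suc n)
  from Suc[of "\<lambda>i. f (Suc i)"] obtain c where "\<forall>i<n. entry c i = f (Suc i)" by blast
  then have "\<forall>i<Suc n. entry (prod_encode (f 0, c)) i = f i"
    by (metis entry_0 entry_Suc less_Suc_eq_0_disj)
  then show ?case ..
qed simp

section \<open>Recursion on the history and the greedy coding bijection\<close>

text \<open>A greedy construction is computable when its stage condition is decidable from a code of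
  the earlier choices: each stage takes the least admissible value. Solvability for every finite
  \<open>U\<close> guarantees that no stage gets stuck.\<close>

lemma rec_in_course_of_values:
  fixes Q :: "nat \<Rightarrow> nat set \<Rightarrow> nat \<Rightarrow> bool"
  assumes Q: "dec_in h (\<lambda>z. Q (pfst (pfst z)) (entry (psnd (pfst z)) ` {..<pfst (pfst z)}) (psnd z))"
    and ex: "\<And>n U. finite U \<Longrightarrow> \<exists>y. Q n U y"
  shows "\<exists>p. rec_in h p \<and> (\<forall>n. Q n (p ` {..<n}) (p n))"
proof -
  define s where "s n c = (LEAST y. Q n (entry c ` {..<n}) y)" for n c
  have s: "Q n (entry c ` {..<n}) (s n c)" for n c
    unfolding s_def by (rule LeastI_ex) (simp add: ex)
  have rec_s: "rec_in h (\<lambda>z. s (pfst z) (psnd z))"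
    unfolding s_def by (rule rec_in_Least[OF Q]) (simp add: ex)
  have rec_s2: "rec_in h (\<lambda>z. s (f z) (g z))" if "rec_in h f" "rec_in h g" for f g
    using rec_in_comp[OF rec_s rec_in_pair[OF that]] by simp
  \<comment> \<open>\<open>T n\<close> codes the history before stage \<open>n\<close>, newest value
    first. The reversed order is harmless because \<open>Q\<close> sees only the set of values, and
    the initial code 0 is arbitrary because stage 0 reads no entry.\<close>
  define T where "T n = rec_nat 0 (\<lambda>n c. prod_encode (s n c, c)) n" for n
  define p where "p n = s n (T n)" for n
  have "rec_in h p"
    unfolding p_def T_def by (intro rec_s2 rec_in_rec_nat rec_in_intros)
  moreover have "entry (T n) ` {..<n} = p ` {..<n}" for n
  proof (induction n)
    case (Suc n)
    have T: "T (Suc n) = prod_encode (p n, T n)"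
      by (simp add: T_def p_def)
    have "entry (T (Suc n)) ` {..<Suc n} = insert (p n) (entry (T n) ` {..<n})"
      unfolding T lessThan_Suc_eq_insert_0 by (simp add: image_image)
    then show ?case
      by (simp add: Suc lessThan_Suc)
  qed simp
  ultimately show ?thesis
    using s unfolding p_def by metis
qed

lemma coding_enumeration:
  assumes R: "dec_in h R" and E: "dec_in h (\<lambda>z. E (pfst z) (psnd z))"
    and X: "dec_in h (\<lambda>x. x \<in> X)"
    and V: "V = {pfst c | c. R c}"
    and fresh: "\<And>U b. finite U \<Longrightarrow> \<exists>x\<in>V - U. \<exists>y\<in>V - U. x \<noteq> y \<and> (E x y \<longleftrightarrow> b)"
  shows "\<exists>p. rec_in h p \<and> bij_betw p UNIV V \<and> (\<forall>n. E (p (3 * n)) (p (3 * n + 1)) \<longleftrightarrow> n \<in> X)"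
proof -
  \<comment> \<open>Stage \<open>n\<close> fixes the values at \<open>3n\<close>, \<open>3n + 1\<close>, \<open>3n + 2\<close>: the first two code whether \<open>n \<in> X\<close>,
    the third has the least code among the unused values, which makes the function onto.\<close>
  define v where "v i e = pfst (if i = 0 then pfst (psnd e) else if i = 1 then psnd (psnd e) else pfst e)"
    for i e :: nat
  define used where "used U z \<longleftrightarrow> (\<exists>e\<in>U. z = v 0 e \<or> z = v 1 e \<or> z = v 2 e)" for U z
  \<comment> \<open>A stage value is a triple of codes \<open>e = <c, <a, b>>\<close>:
    \<open>a\<close> and \<open>b\<close> give the coding pair and \<open>c\<close> the third
    element. The last clause says that every smaller code names an element used already.\<close>
  define Q where "Q n U e \<longleftrightarrow> R (pfst e) \<and> R (pfst (psnd e)) \<and> R (psnd (psnd e)) \<and>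
      \<not> used U (v 0 e) \<and> \<not> used U (v 1 e) \<and> \<not> used U (v 2 e) \<and>
      v 0 e \<noteq> v 1 e \<and> v 0 e \<noteq> v 2 e \<and> v 1 e \<noteq> v 2 e \<and>
      (E (v 0 e) (v 1 e) \<longleftrightarrow> n \<in> X) \<and> (\<forall>c<pfst e. R c \<longrightarrow> used U (pfst c))" for n U e
  \<comment> \<open>With the history given by a code, being used is a bounded quantifier, to which
    the closure rules for \<open>dec_in\<close> apply.\<close>
  have used_entry: "used (entry t ` {..<n}) z \<longleftrightarrow>
      (\<exists>j<n. z = v 0 (entry t j) \<or> z = v 1 (entry t j) \<or> z = v 2 (entry t j))" for t n z
    by (auto simp: used_def)
  note compR = dec_in_comp[OF R] and compX = dec_in_comp[OF X]
  have compE: "dec_in h (\<lambda>x. E (f x) (g x))" if "rec_in h f" "rec_in h g" for f g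
    using dec_in_comp[OF E rec_in_pair[OF that]] by simp
  have rec_v: "rec_in h (\<lambda>x. v (f x) (g x))" if "rec_in h f" "rec_in h g" for f g
    unfolding v_def by (intro rec_in_intros that)
  have "\<exists>p. rec_in h p \<and> (\<forall>n. Q n (p ` {..<n}) (p n))"
  proof (rule rec_in_course_of_values)
    show "dec_in h (\<lambda>z. Q (pfst (pfst z)) (entry (psnd (pfst z)) ` {..<pfst (pfst z)}) (psnd z))"
      unfolding Q_def used_entry
      by (intro rec_in_intros compR compX compE rec_v rec_in_entry)
  next
    fix n :: nat and U :: "nat set"
    assume U: "finite U"
    define W where "W = v 0 ` U \<union> v 1 ` U \<union> v 2 ` U"
    have used: "used U z \<longleftrightarrow> z \<in> W" for z
      by (auto simp: used_def W_def)
    have W: "finite W" using U by (simp add: W_def)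
    have "\<exists>c. R c \<and> \<not> used U (pfst c)"
      using fresh[OF W] by (auto simp: V used)
    then have c: "R (LEAST c. R c \<and> \<not> used U (pfst c)) \<and> \<not> used U (pfst (LEAST c. R c \<and> \<not> used U (pfst c)))"
      by (rule LeastI_ex)
    define c where "c = (LEAST c. R c \<and> \<not> used U (pfst c))"
    have c_least: "used U (pfst c')" if "c' < c" "R c'" for c'
      using that not_less_Least unfolding c_def by blast
    \<comment> \<open>The element named by \<open>c\<close> is excluded as well, so that the three
      elements of the stage are distinct.\<close>
    obtain x y where xy: "x \<in> V - insert (pfst c) W" "y \<in> V - insert (pfst c) W" "x \<noteq> y"
      "E x y \<longleftrightarrow> n \<in> X"
      using fresh[of "insert (pfst c) W" "n \<in> X"] W by auto
    then obtain a b where ab: "R a" "R b" "x = pfst a" "y = pfst b"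
      by (auto simp: V)
    have "Q n U (prod_encode (c, prod_encode (a, b)))"
      using c xy ab c_least unfolding Q_def v_def c_def[symmetric] by (simp add: used)
    then show "\<exists>e. Q n U e" ..
  qed
  then obtain p where p: "rec_in h p" and Qp: "\<And>n. Q n (p ` {..<n}) (p n)" by blast
  define q where "q m = v (m mod 3) (p (m div 3))" for m
  have rec_q: "rec_in h q"
    unfolding q_def by (intro rec_v rec_in_comp[OF p] rec_in_mod rec_in_div rec_in_id) simp_all
  have v_cases: "v (m mod 3) e = v 0 e \<and> m mod 3 = 0 \<or> v (m mod 3) e = v 1 e \<and> m mod 3 = 1 \<or>
      v (m mod 3) e = v 2 e \<and> m mod 3 = 2" for m e
  proof -
    have "m mod 3 = 0 \<or> m mod 3 = 1 \<or> m mod 3 = 2" by presburger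
    then show ?thesis by auto
  qed
  have new: "q m \<noteq> q m'" if "m div 3 < m' div 3" for m m'
  proof -
    have "used (p ` {..<m' div 3}) (q m)"
      using that v_cases[of m "p (m div 3)"] unfolding used_def q_def by force
    moreover have "\<not> used (p ` {..<m' div 3}) (q m')"
      using Qp[of "m' div 3"] v_cases[of m' "p (m' div 3)"] unfolding Q_def q_def by auto
    ultimately show ?thesis by metis
  qed
  have "inj q"
  proof (rule injI, rule ccontr)
    fix m m' assume *: "q m = q m'" "m \<noteq> m'"
    then have eq: "m div 3 = m' div 3"
      using new by (metis linorder_neqE_nat)
    then have "m mod 3 \<noteq> m' mod 3"
      using *(2) by (metis mult_div_mod_eq)
    then show False
      using Qp[of "m' div 3"] v_cases[of m "p (m div 3)"] v_cases[of m' "p (m' div 3)"] *(1) eq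
      unfolding Q_def q_def by auto
  qed
  moreover have "q m \<in> V" for m
    using Qp[of "m div 3"] v_cases[of m "p (m div 3)"]
    unfolding Q_def q_def V by (auto simp: v_def)
  \<comment> \<open>Surjectivity: the third codes \<open>?c n\<close> increase strictly, since a
    later one that is smaller or equal would name an element used before. Hence a code
    \<open>c\<close> of \<open>z\<close> lies below \<open>?c (Suc c)\<close>, and minimality at
    that stage shows that \<open>z\<close> has been used.\<close>
  moreover have "\<exists>m. z = q m" if z: "z \<in> V" for z
  proof -
    obtain c where c: "R c" "z = pfst c" using z by (auto simp: V)
    let ?c = "\<lambda>n. pfst (p n)"
    have "?c n < ?c (Suc n)" for n
    proof (rule ccontr)
      assume "\<not> ?c n < ?c (Suc n)"
      then consider "?c (Suc n) < ?c n" | "?c (Suc n) = ?c n" by linarith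
      then show False
      proof cases
        case 1
        then have "used (p ` {..<n}) (v 2 (p (Suc n)))"
          using Qp[of n] Qp[of "Suc n"] by (simp add: Q_def v_def)
        then have "used (p ` {..<Suc n}) (v 2 (p (Suc n)))"
          by (auto simp: used_def lessThan_Suc)
        then show False
          using Qp[of "Suc n"] by (simp add: Q_def)
      next
        case 2
        then have "v 2 (p (Suc n)) = v 2 (p n)" by (simp add: v_def)
        then have "used (p ` {..<Suc n}) (v 2 (p (Suc n)))"
          by (auto simp: used_def lessThan_Suc)
        then show False
          using Qp[of "Suc n"] by (simp add: Q_def)
      qed
    qed
    then have "strict_mono ?c" by (simp add: strict_mono_Suc_iff)
    then have "c < ?c (Suc c)" by (meson Suc_le_lessD strict_mono_imp_increasing)
    then have "used (p ` {..<Suc c}) z"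
      using Qp[of "Suc c"] c by (simp add: Q_def)
    then obtain n i where "z = v i (p n)" "i < 3"
      unfolding used_def by force
    then have "z = q (3 * n + i)" by (simp add: q_def)
    then show ?thesis ..
  qed
  ultimately have "bij_betw q UNIV V"
    unfolding bij_betw_def by blast
  moreover have "E (q (3 * n)) (q (3 * n + 1)) \<longleftrightarrow> n \<in> X" for n
  proof -
    have "Suc (3 * n) div 3 = n" "Suc (3 * n) mod 3 = 1" by presburger+
    then show ?thesis
      using Qp[of n] by (simp add: Q_def q_def)
  qed
  ultimately show ?thesis
    using rec_q by blast
qed

section \<open>Embeddings of graphs\<close>

lemma embedding_iff:
  "embedding f G H \<longleftrightarrow> inj_on f (verts G) \<and> f ` verts G \<subseteq> verts H \<and>
    (\<forall>u\<in>verts G. \<forall>v\<in>verts G. (u, v) \<in> edges G \<longleftrightarrow> (f u, f v) \<in> edges H)"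
  unfolding embedding_def isomorphism_def bij_betw_def induced_on_def by auto

lemma embeds_refl: "G \<hookrightarrow>\<^sub>G G"
  unfolding embeds_def embedding_iff by (rule exI[of _ id]) simp

lemma embeds_trans:
  assumes "G \<hookrightarrow>\<^sub>G H" "H \<hookrightarrow>\<^sub>G K"
  shows "G \<hookrightarrow>\<^sub>G K"
proof -
  obtain f g where f: "embedding f G H" and g: "embedding g H K"
    using assms unfolding embeds_def by blast
  have "f u \<in> verts H" if "u \<in> verts G" for u
    using f that unfolding embedding_iff by blast
  then have "embedding (g \<circ> f) G K"
    using f g unfolding embedding_iff
    by (auto intro!: comp_inj_on intro: inj_on_subset)
  then show ?thesis
    unfolding embeds_def by blast
qed

lemma isomorphic_imp_embeds: "G \<cong>\<^sub>G H \<Longrightarrow> G \<hookrightarrow>\<^sub>G H"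
  unfolding isomorphic_def embeds_def embedding_iff isomorphism_def bij_betw_def by blast

lemma isomorphic_refl: "G \<cong>\<^sub>G G"
  unfolding isomorphic_def isomorphism_def by (rule exI[of _ id]) simp

lemma isomorphic_imp_bi_embeddable: "G \<cong>\<^sub>G H \<Longrightarrow> G \<approx>\<^sub>G H"
  unfolding bi_embeddable_def by (blast intro: isomorphic_imp_embeds isomorphic_sym)

lemma bi_embeddable_trans: "G \<approx>\<^sub>G H \<Longrightarrow> H \<approx>\<^sub>G K \<Longrightarrow> G \<approx>\<^sub>G K"
  unfolding bi_embeddable_def by (blast intro: embeds_trans)

lemma strictly_embeds_trans: "G <\<^sub>G H \<Longrightarrow> H <\<^sub>G K \<Longrightarrow> G <\<^sub>G K"
  unfolding strictly_embeds_def by (blast intro: embeds_trans)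

section \<open>Assembling embeddings from pieces\<close>

text \<open>The labels \<open>k\<close> and \<open>l\<close> are constant along edges, so different
  label classes are not joined by edges. Embeddings of the classes of \<open>G\<close> into distinct
  classes of \<open>H\<close> therefore unite to one embedding. Labels will be components on one
  side and indices of a disjoint union on the other.\<close>

lemma embeds_glue:
  assumes kG: "\<And>u v. (u, v) \<in> edges G \<Longrightarrow> k u = k v"
    and lH: "\<And>u v. (u, v) \<in> edges H \<Longrightarrow> l u = l v"
    and m: "inj_on m (k ` verts G)"
    and part: "\<And>i. i \<in> k ` verts G \<Longrightarrow>
      induced_on G {v \<in> verts G. k v = i} \<hookrightarrow>\<^sub>G induced_on H {w \<in> verts H. l w = m i}"
  shows "G \<hookrightarrow>\<^sub>G H"
proof -
  have "\<forall>i\<in>k ` verts G. \<exists>f.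
      embedding f (induced_on G {v \<in> verts G. k v = i}) (induced_on H {w \<in> verts H. l w = m i})"
    using part unfolding embeds_def by blast
  from bchoice[OF this] obtain f where f: "\<And>i. i \<in> k ` verts G \<Longrightarrow>
      embedding (f i) (induced_on G {v \<in> verts G. k v = i}) (induced_on H {w \<in> verts H. l w = m i})"
    by blast
  define g where "g v = f (k v) v" for v
  have gH: "g v \<in> verts H" and lg: "l (g v) = m (k v)" if "v \<in> verts G" for v
    using f[of "k v"] that unfolding embedding_iff g_def by (auto simp: induced_on_def)
  have same: "(u, v) \<in> edges G \<longleftrightarrow> (g u, g v) \<in> edges H" "g u = g v \<Longrightarrow> u = v"
    if "u \<in> verts G" "v \<in> verts G" "k u = k v" for u v
    using f[of "k v"] that gH[of u] gH[of v] lg[of u] lg[of v]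
    unfolding embedding_iff g_def by (auto simp: induced_on_def dest: inj_onD)
  have eq: "k u = k v" if "u \<in> verts G" "v \<in> verts G" "l (g u) = l (g v)" for u v
    using that lg m by (auto dest: inj_onD)
  have "embedding g G H"
    unfolding embedding_iff
  proof (intro conjI ballI)
    show "inj_on g (verts G)"
      using eq same(2) by (intro inj_onI) metis
    show "g ` verts G \<subseteq> verts H"
      using gH by blast
    show "(u, v) \<in> edges G \<longleftrightarrow> (g u, g v) \<in> edges H" if "u \<in> verts G" "v \<in> verts G" for u v
      using eq same(1) that kG lH by metis
  qed
  then show ?thesis
    unfolding embeds_def by blast
qed

text \<open>Run through \<open>I\<close> along \<open>to_nat_on I\<close> and choose each value
  outside the finitely many earlier ones. Numbers outside the range of \<open>to_nat_on I\<close>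
  are left unconstrained.\<close>

lemma injective_choice:
  fixes K :: "'i \<Rightarrow> 'a set"
  assumes I: "countable I" and K: "\<And>i. i \<in> I \<Longrightarrow> infinite (K i)"
  shows "\<exists>m. inj_on m I \<and> (\<forall>i\<in>I. m i \<in> K i)"
proof -
  have "\<exists>f. \<forall>n. n \<in> to_nat_on I ` I \<longrightarrow> f n \<in> K (from_nat_into I n) - f ` {..<n}"
  proof (rule dependent_wf_choice[of less_than])
    show "\<exists>r. n \<in> to_nat_on I ` I \<longrightarrow> r \<in> K (from_nat_into I n) - f ` {..<n}"
      for n and f :: "nat \<Rightarrow> 'a"
    proof (cases "n \<in> to_nat_on I ` I")
      case True
      then have "from_nat_into I n \<in> I" using I by auto
      then have "infinite (K (from_nat_into I n) - f ` {..<n})"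
        by (intro Diff_infinite_finite K) simp_all
      then show ?thesis
        by (metis finite.emptyI ex_in_conv)
    qed simp
  next
    fix f g :: "nat \<Rightarrow> 'a" and n :: nat
    assume "\<And>z. (z, n) \<in> less_than \<Longrightarrow> f z = g z"
    then have "f ` {..<n} = g ` {..<n}" by (intro image_cong) auto
    then show "(n \<in> to_nat_on I ` I \<longrightarrow> x \<in> K (from_nat_into I n) - f ` {..<n}) =
        (n \<in> to_nat_on I ` I \<longrightarrow> x \<in> K (from_nat_into I n) - g ` {..<n})" for x
      by simp
  qed simp
  then obtain f where f: "\<And>n. n \<in> to_nat_on I ` I \<Longrightarrow> f n \<in> K (from_nat_into I n) - f ` {..<n}"
    by blast
  have "inj_on f (to_nat_on I ` I)"
  proof (rule linorder_inj_onI)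
    fix a b assume "a < b" "a \<in> to_nat_on I ` I" "b \<in> to_nat_on I ` I"
    then show "f a \<noteq> f b" using f[of b] by (metis DiffE imageI lessThan_iff)
  qed auto
  then have "inj_on (f \<circ> to_nat_on I) I"
    by (rule comp_inj_on[OF inj_on_to_nat_on[OF I]])
  moreover have "(f \<circ> to_nat_on I) i \<in> K i" if "i \<in> I" for i
    using f[of "to_nat_on I i"] I that by simp
  ultimately show ?thesis by blast
qed


section \<open>Components\<close>

definition component_of :: "'a ugraph \<Rightarrow> 'a \<Rightarrow> 'a ugraph" where
  "component_of G v = induced_on G {w. (v, w) \<in> (edges G)\<^sup>*}"

lemma ugraph_components_eq: "ugraph_components G = component_of G ` verts G"
  unfolding ugraph_components_def component_of_def ..

lemma component_of_eq:
  assumes "simple_ugraph G" "(u, v) \<in> (edges G)\<^sup>*"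
  shows "component_of G u = component_of G v"
proof -
  have "sym ((edges G)\<^sup>*)"
    using assms(1) by (intro sym_rtrancl) (simp add: simple_ugraph_def)
  then have "(u, w) \<in> (edges G)\<^sup>* \<longleftrightarrow> (v, w) \<in> (edges G)\<^sup>*" for w
    using assms(2) by (meson rtrancl_trans symD)
  then show ?thesis by (simp add: component_of_def)
qed

text \<open>Puts a component into the shape that \<open>embeds_glue\<close> expects, with
  \<open>component_of G\<close> as the label map.\<close>

lemma induced_on_component_class:
  assumes G: "simple_ugraph G" and C: "C \<in> ugraph_components G"
  shows "induced_on G {v \<in> verts G. component_of G v = C} = C"
proof -
  obtain v where v: "v \<in> verts G" "C = component_of G v"
    using C by (auto simp: ugraph_components_eq)
  have "verts C \<subseteq> verts G"
    using component_simple_connected(3)[OF G v(1)] v(2) by (simp add: component_of_def)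
  moreover have "w \<in> verts (component_of G w)" for w
    by (simp add: component_of_def induced_on_def)
  ultimately have "{w \<in> verts G. component_of G w = C} = verts C"
    using component_of_eq[OF G] v(2) by (auto simp: component_of_def induced_on_def)
  then show ?thesis
    by (simp add: v component_of_def induced_on_def)
qed

lemma component_embeds:
  assumes "simple_ugraph G" "C \<in> ugraph_components G"
  shows "C \<hookrightarrow>\<^sub>G G"
proof -
  have "induced_on G {v \<in> verts G. component_of G v = C} \<hookrightarrow>\<^sub>G G"
    unfolding embeds_def embedding_iff by (rule exI[of _ id]) (auto simp: induced_on_def)
  then show ?thesis
    by (simp add: induced_on_component_class[OF assms])
qed

text \<open>An embedding maps paths to paths, so the image of a connected graph stays in the
  component of the image of any one vertex.\<close>

lemma connected_embeds_in_component:
  assumes G: "simple_ugraph G" and H: "simple_ugraph H" "ugraph_connected H" and HG: "H \<hookrightarrow>\<^sub>G G"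
  shows "\<exists>C\<in>ugraph_components G. H \<hookrightarrow>\<^sub>G C"
proof -
  obtain f where f: "embedding f H G" using HG by (auto simp: embeds_def)
  obtain v where v: "v \<in> verts H" using H(1) by (auto simp: simple_ugraph_def)
  have EH: "edges H \<subseteq> verts H \<times> verts H" using H(1) by (simp add: simple_ugraph_def)
  have "(f v, f w) \<in> (edges G)\<^sup>*" if "(v, w) \<in> (edges H)\<^sup>*" for w
    using that
  proof (induction rule: rtrancl_induct)
    case (step y z)
    then have "(f y, f z) \<in> edges G"
      using f EH unfolding embedding_iff by blast
    with step.IH show ?case by simp
  qed simp
  then have "f ` verts H \<subseteq> verts (component_of G (f v))"
    using H(2) v by (auto simp: ugraph_connected_def component_of_def induced_on_def)
  then have "embedding f H (component_of G (f v))"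
    using f unfolding embedding_iff by (auto simp: component_of_def induced_on_def)
  moreover have "f v \<in> verts G"
    using f v unfolding embedding_iff by blast
  ultimately show ?thesis
    unfolding ugraph_components_eq embeds_def by blast
qed

lemma embeds_infinite:
  assumes "G \<hookrightarrow>\<^sub>G H" "infinite (verts G)"
  shows "infinite (verts H)"
  using assms unfolding embeds_def embedding_iff by (meson finite_imageD finite_subset)

lemma ugraph_trace_mono: "G \<hookrightarrow>\<^sub>G H \<Longrightarrow> ugraph_trace F G \<subseteq> ugraph_trace F H"
  unfolding ugraph_trace_def by (auto intro: embeds_trans)


section \<open>Open-ended graphs and their skeletons\<close>

lemma friedberg_enumerationD:
  assumes "friedberg_enumeration F"
  shows "simple_ugraph (F i)" "finite (verts (F i))" "ugraph_connected (F i)"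
    and "F i \<cong>\<^sub>G F j \<Longrightarrow> i = j"
proof -
  show *: "simple_ugraph (F i)" "finite (verts (F i))" "ugraph_connected (F i)" for i
    using assms by (auto simp: friedberg_enumeration_def omega_ugraph_def)
  have "\<exists>!j. F i \<cong>\<^sub>G F j"
    using assms * unfolding friedberg_enumeration_def by blast
  then show "i = j" if "F i \<cong>\<^sub>G F j"
    using that isomorphic_refl by blast
qed

lemma component_isomorphic_enumerated:
  fixes G :: "nat ugraph"
  assumes F: "friedberg_enumeration F" and G: "simple_ugraph G" "strongly_locally_finite G"
    and C: "C \<in> ugraph_components G"
  shows "\<exists>i\<in>ugraph_trace F G. C \<cong>\<^sub>G F i"
proof -
  obtain v where v: "v \<in> verts G" "C = component_of G v"
    using C by (auto simp: ugraph_components_eq)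
  have "simple_ugraph C" "ugraph_connected C"
    using component_simple_connected[OF G(1) v(1)] v(2) by (simp_all add: component_of_def)
  moreover have "finite (verts C)"
    using G(2) C by (simp add: strongly_locally_finite_def)
  ultimately obtain i where i: "C \<cong>\<^sub>G F i"
    using F unfolding friedberg_enumeration_def by blast
  then have "F i \<hookrightarrow>\<^sub>G G"
    by (rule embeds_trans[OF isomorphic_imp_embeds[OF isomorphic_sym] component_embeds[OF G(1) C]])
  with i show ?thesis by (auto simp: ugraph_trace_def)
qed

text \<open>An ascending chain through \<open>C\<close> supplies both infinite sets: by strictness
  no later member embeds into an earlier one, so the members are pairwise distinct and even pairwise
  non-isomorphic, and their indices in the enumeration differ too.\<close>

lemma open_ended_infinitely_many_above:
  fixes G :: "nat ugraph"
  assumes F: "friedberg_enumeration F" and G: "simple_ugraph G" "strongly_locally_finite G"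
    and op: "open_ended G" and C: "C \<in> ugraph_components G"
  shows "infinite {D \<in> ugraph_components G. C \<hookrightarrow>\<^sub>G D}"
    and "infinite {i \<in> ugraph_trace F G. C \<hookrightarrow>\<^sub>G F i}"
proof -
  obtain c n where c: "\<And>k. c k \<in> ugraph_components G" "\<And>k. c k <\<^sub>G c (Suc k)" "c n = C"
    using bspec[OF op[unfolded open_ended_def] C] unfolding open_component_def by auto
  \<comment> \<open>\<open>C\<close> may occur anywhere in the chain, so the part before it is cut
    off.\<close>
  define d where "d k = c (n + k)" for k
  have d: "d k \<in> ugraph_components G" for k
    by (simp add: d_def c)
  have less: "d j <\<^sub>G d k" if "j < k" for j k
    using that
  proof (induction k)
    case (Suc k)
    have "d k <\<^sub>G d (Suc k)" by (simp add: d_def c)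
    with Suc show ?case
      by (metis less_Suc_eq strictly_embeds_trans)
  qed simp
  have above: "C \<hookrightarrow>\<^sub>G d k" for k
  proof (cases k)
    case 0
    then show ?thesis using c(3) embeds_refl[of C] by (simp add: d_def)
  next
    case (Suc j)
    then have "d 0 <\<^sub>G d k" by (intro less) simp
    then show ?thesis using c(3) by (simp add: d_def strictly_embeds_def)
  qed
  have "inj d"
    by (rule linorder_injI) (use less embeds_refl in \<open>metis strictly_embeds_def\<close>)
  then have "infinite (range d)"
    using finite_imageD infinite_UNIV_nat by blast
  moreover have "range d \<subseteq> {D \<in> ugraph_components G. C \<hookrightarrow>\<^sub>G D}"
    using d above by blast
  ultimately show "infinite {D \<in> ugraph_components G. C \<hookrightarrow>\<^sub>G D}"
    using finite_subset by blast
  have "\<forall>k. \<exists>i. i \<in> ugraph_trace F G \<and> d k \<cong>\<^sub>G F i"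
    using component_isomorphic_enumerated[OF F G d] by blast
  then obtain t where t: "\<And>k. t k \<in> ugraph_trace F G" "\<And>k. d k \<cong>\<^sub>G F (t k)"
    by metis
  have "inj t"
  proof (rule linorder_injI)
    fix j k :: nat assume "j < k"
    then have "\<not> d k \<cong>\<^sub>G d j"
      using less[of j k] isomorphic_imp_embeds[of "d k" "d j"] unfolding strictly_embeds_def by blast
    then show "t j \<noteq> t k"
      using isomorphic_trans[OF t(2)[of k], of "d j"] isomorphic_sym[OF t(2)[of j]] by auto
  qed
  then have "infinite (range t)"
    using finite_imageD infinite_UNIV_nat by blast
  moreover have "range t \<subseteq> {i \<in> ugraph_trace F G. C \<hookrightarrow>\<^sub>G F i}"
    using t(1) embeds_trans[OF above isomorphic_imp_embeds[OF t(2)]] by blast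
  ultimately show "infinite {i \<in> ugraph_trace F G. C \<hookrightarrow>\<^sub>G F i}"
    using finite_subset by blast
qed

lemma open_ended_infinite_trace:
  fixes G :: "nat ugraph"
  assumes "friedberg_enumeration F" "simple_ugraph G" "strongly_locally_finite G" "open_ended G"
  shows "infinite (ugraph_trace F G)"
proof -
  obtain v where "v \<in> verts G" using assms(2) by (auto simp: simple_ugraph_def)
  then have "component_of G v \<in> ugraph_components G" by (simp add: ugraph_components_eq)
  from open_ended_infinitely_many_above(2)[OF assms this] show ?thesis
    by (auto intro: finite_subset)
qed

lemma open_ended_infinite:
  fixes G :: "nat ugraph"
  assumes "friedberg_enumeration F" "simple_ugraph G" "strongly_locally_finite G" "open_ended G"
  shows "infinite (verts G)"
proof -
  obtain v where "v \<in> verts G" using assms(2) by (auto simp: simple_ugraph_def)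
  then have "component_of G v \<in> ugraph_components G" by (simp add: ugraph_components_eq)
  from open_ended_infinitely_many_above(1)[OF assms this] have "infinite (ugraph_components G)"
    by (auto intro: finite_subset)
  then show ?thesis by (auto simp: ugraph_components_eq)
qed

text \<open>In either direction each piece has infinitely many possible targets;
  \<open>injective_choice\<close> selects distinct ones and \<open>embeds_glue\<close> joins the
  resulting embeddings.\<close>

lemma open_ended_bi_embeddable_union:
  fixes G :: "nat ugraph"
  assumes F: "friedberg_enumeration F" and G: "simple_ugraph G" "strongly_locally_finite G"
    and op: "open_ended G"
  shows "disjoint_union (ugraph_trace F G) F \<approx>\<^sub>G G"
proof -
  let ?I = "ugraph_trace F G"
  let ?D = "disjoint_union ?I F"
  note Fs = friedberg_enumerationD[OF F]
  have kG: "component_of G u = component_of G v" if "(u, v) \<in> edges G" for u v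
    using that by (intro component_of_eq[OF G(1)]) simp
  have kD: "fst u = fst v" if "(u, v) \<in> edges ?D" for u v
    using that by (auto simp: disjoint_union_def)
  have imgD: "fst ` verts ?D = ?I"
    using Fs(1) by (force simp: disjoint_union_def simple_ugraph_def image_iff)
  have pieceD: "F i \<cong>\<^sub>G induced_on ?D {w \<in> verts ?D. fst w = i}" if "i \<in> ?I" for i
  proof -
    have "isomorphism (Pair i) (F i) (induced_on ?D {w \<in> verts ?D. fst w = i})"
      using that unfolding isomorphism_def bij_betw_def
      by (auto simp: disjoint_union_def induced_on_def inj_on_def)
    then show ?thesis unfolding isomorphic_def by blast
  qed
  have "?D \<hookrightarrow>\<^sub>G G"
  proof -
    \<comment> \<open>\<open>F i\<close> is connected and so embeds into a single component;
      everything above that component is above \<open>F i\<close>.\<close>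
    have "infinite {D \<in> ugraph_components G. F i \<hookrightarrow>\<^sub>G D}" if i: "i \<in> ?I" for i
    proof -
      obtain C where C: "C \<in> ugraph_components G" "F i \<hookrightarrow>\<^sub>G C"
        using connected_embeds_in_component[OF G(1) Fs(1,3)] i by (auto simp: ugraph_trace_def)
      then have "{D \<in> ugraph_components G. C \<hookrightarrow>\<^sub>G D} \<subseteq> {D \<in> ugraph_components G. F i \<hookrightarrow>\<^sub>G D}"
        using embeds_trans[OF C(2)] by blast
      then show ?thesis
        using open_ended_infinitely_many_above(1)[OF F G op C(1)] finite_subset by blast
    qed
    then obtain m where m: "inj_on m ?I" "\<And>i. i \<in> ?I \<Longrightarrow> m i \<in> ugraph_components G"
      "\<And>i. i \<in> ?I \<Longrightarrow> F i \<hookrightarrow>\<^sub>G m i"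
      using injective_choice[of ?I "\<lambda>i. {D \<in> ugraph_components G. F i \<hookrightarrow>\<^sub>G D}"] by auto
    show ?thesis
    proof (rule embeds_glue[OF kD kG])
      show "inj_on m (fst ` verts ?D)"
        unfolding imgD by (rule m(1))
    next
      fix i assume "i \<in> fst ` verts ?D"
      then have i: "i \<in> ?I" by (simp only: imgD)
      show "induced_on ?D {v \<in> verts ?D. fst v = i}
          \<hookrightarrow>\<^sub>G induced_on G {w \<in> verts G. component_of G w = m i}"
        unfolding induced_on_component_class[OF G(1) m(2)[OF i]]
        by (rule embeds_trans[OF isomorphic_imp_embeds[OF isomorphic_sym[OF pieceD[OF i]]] m(3)[OF i]])
    qed
  qed
  moreover have "G \<hookrightarrow>\<^sub>G ?D"
  proof -
    have "countable (ugraph_components G)" by (simp add: ugraph_components_eq)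
    then obtain m where m: "inj_on m (ugraph_components G)"
      "\<And>C. C \<in> ugraph_components G \<Longrightarrow> m C \<in> ?I"
      "\<And>C. C \<in> ugraph_components G \<Longrightarrow> C \<hookrightarrow>\<^sub>G F (m C)"
      using injective_choice[of "ugraph_components G" "\<lambda>C. {i \<in> ?I. C \<hookrightarrow>\<^sub>G F i}"]
        open_ended_infinitely_many_above(2)[OF F G op] by auto
    show ?thesis
    proof (rule embeds_glue[OF kG kD])
      show "inj_on m (component_of G ` verts G)"
        using m(1) by (simp only: ugraph_components_eq)
    next
      fix C assume "C \<in> component_of G ` verts G"
      then have C: "C \<in> ugraph_components G" by (simp only: ugraph_components_eq)
      show "induced_on G {v \<in> verts G. component_of G v = C}
          \<hookrightarrow>\<^sub>G induced_on ?D {w \<in> verts ?D. fst w = m C}"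
        unfolding induced_on_component_class[OF G(1) C]
        by (rule embeds_trans[OF m(3)[OF C] isomorphic_imp_embeds[OF pieceD[OF m(2)[OF C]]]])
    qed
  qed
  ultimately show ?thesis
    unfolding bi_embeddable_def by blast
qed

text \<open>Provides the hypothesis \<open>fresh\<close> of \<open>coding_enumeration\<close>.
  Discard the indices of pieces that meet \<open>U\<close> and the at most one index of a one-vertex
  graph: any remaining piece contains an edge, and two remaining pieces give a non-adjacent
  pair.\<close>

lemma union_edges_avoiding_finite:
  assumes F: "friedberg_enumeration F" and I: "infinite I" and U: "finite U"
  defines "D \<equiv> disjoint_union I F"
  shows "\<exists>x\<in>verts D - U. \<exists>y\<in>verts D - U. x \<noteq> y \<and> ((x, y) \<in> edges D \<longleftrightarrow> b)"
proof -
  note Fs = friedberg_enumerationD[OF F]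
  let ?J = "I - fst ` U - {i. card (verts (F i)) = 1}"
  have unique: "i = j" if "card (verts (F i)) = 1" "card (verts (F j)) = 1" for i j
  proof -
    obtain u v where uv: "verts (F i) = {u}" "verts (F j) = {v}"
      using \<open>card (verts (F i)) = 1\<close> \<open>card (verts (F j)) = 1\<close> by (auto simp: card_1_singleton_iff)
    have "isomorphism (\<lambda>_. v) (F i) (F j)"
      using uv Fs(1)[of i] Fs(1)[of j]
      by (auto simp: isomorphism_def bij_betw_def simple_ugraph_def irrefl_def)
    then show ?thesis
      using Fs(4) by (auto simp: isomorphic_def)
  qed
  have "finite {i. card (verts (F i)) = 1}"
  proof (cases "\<exists>i. card (verts (F i)) = 1")
    case True
    then obtain i where "card (verts (F i)) = 1" ..
    then have "{i. card (verts (F i)) = 1} = {i}" using unique by blast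
    then show ?thesis by simp
  qed simp
  then have J: "infinite ?J"
    using I U by (intro Diff_infinite_finite) auto
  obtain i where i: "i \<in> ?J" using J by (metis finite.emptyI ex_in_conv)
  obtain j where j: "j \<in> ?J" "j \<noteq> i"
    using infinite_remove[OF J, of i] by (metis finite.emptyI ex_in_conv DiffE singletonI)
  obtain u where u: "u \<in> verts (F i)" using Fs(1)[of i] by (auto simp: simple_ugraph_def)
  show ?thesis
  proof (cases b)
    case True
    have "verts (F i) \<noteq> {u}" using i by auto
    then obtain w where w: "w \<in> verts (F i)" "w \<noteq> u" using u by blast
    \<comment> \<open>A path from \<open>u\<close> to a different vertex begins with an edge at
      \<open>u\<close>.\<close>
    then have "(u, w) \<in> (edges (F i))\<^sup>*"
      using Fs(3)[of i] u by (simp add: ugraph_connected_def)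
    then obtain v where v: "(u, v) \<in> edges (F i)"
      using w(2) by (metis converse_rtranclE)
    then have "v \<in> verts (F i)" "u \<noteq> v"
      using Fs(1)[of i] by (auto simp: simple_ugraph_def irrefl_def)
    then show ?thesis
      using True u v i unfolding D_def disjoint_union_def
      by (intro bexI[of _ "(i, u)"] bexI[of _ "(i, v)"]) (auto simp: image_iff)
  next
    case False
    obtain v where "v \<in> verts (F j)" using Fs(1)[of j] by (auto simp: simple_ugraph_def)
    then show ?thesis
      using False u i j unfolding D_def disjoint_union_def
      by (intro bexI[of _ "(i, u)"] bexI[of _ "(j, v)"]) (auto simp: image_iff)
  qed
qed

section \<open>Degrees of diagrams\<close>

lemma dec_in_member: "dec_in h (\<lambda>x. x \<in> A) \<longleftrightarrow> rec_in h (char_fun A)"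
proof -
  have "char_fun A = (\<lambda>x. of_bool (x \<in> A))"
    by (simp add: fun_eq_iff char_fun_def)
  then show ?thesis by (simp add: dec_in_def)
qed

lemma turing_reducible_iff: "A \<le>\<^sub>T B \<longleftrightarrow> dec_in (char_fun B) (\<lambda>x. x \<in> A)"
  by (simp add: dec_in_member turing_reducible_def rec_in_def)

lemma turing_reducible_trans:
  assumes "A \<le>\<^sub>T B" "B \<le>\<^sub>T C"
  shows "A \<le>\<^sub>T C"
  using assms rec_in_trans unfolding turing_reducible_iff dec_in_member by blast

lemma turing_degree_cong: "A \<le>\<^sub>T B \<Longrightarrow> B \<le>\<^sub>T A \<Longrightarrow> turing_degree A = turing_degree B"
  unfolding turing_degree_def by (blast intro: turing_reducible_trans)

section \<open>Diagrams and embeddings of finite graphs in arithmetical form\<close>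

text \<open>Eliminates the datatype of literals in favour of the components of a code, so that the
  closure rules for \<open>dec_in\<close> apply to diagrams.\<close>

lemma atomic_diagram_iff:
  "x \<in> atomic_diagram G \<longleftrightarrow>
    pfst (psnd x) \<in> verts G \<and> psnd (psnd x) \<in> verts G \<and>
    (pfst x = 0 \<and> pfst (psnd x) = psnd (psnd x) \<or>
     pfst x = 1 \<and> pfst (psnd x) \<noteq> psnd (psnd x) \<or>
     pfst x = 2 \<and> (pfst (psnd x), psnd (psnd x)) \<in> edges G \<or>
     pfst x = 3 \<and> (pfst (psnd x), psnd (psnd x)) \<notin> edges G)" (is "_ \<longleftrightarrow> ?R")
proof
  assume "x \<in> atomic_diagram G"
  then obtain l where "in_diagram G l" "x = lit_code l"
    by (auto simp: atomic_diagram_def)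
  then show ?R by (cases l) auto
next
  assume R: ?R
  define u v where "u = pfst (psnd x)" and "v = psnd (psnd x)"
  have x: "x = prod_encode (pfst x, prod_encode (u, v))"
    by (simp add: u_def v_def)
  have "\<exists>l. in_diagram G l \<and> prod_encode (pfst x, prod_encode (u, v)) = lit_code l"
    using R unfolding u_def[symmetric] v_def[symmetric]
    by (elim conjE disjE)
      (force intro: exI[of _ "EqL u v"] exI[of _ "NeqL u v"] exI[of _ "AdjL u v"] exI[of _ "NadjL u v"])+
  then show "x \<in> atomic_diagram G"
    unfolding atomic_diagram_def using x by auto
qed

text \<open>The number \<open>c\<close> lists the vertices of \<open>H\<close> without repetition, and \<open>d\<close> their images
  under an embedding into \<open>B\<close>.\<close>

definition codes_embedding :: "nat ugraph \<Rightarrow> nat ugraph \<Rightarrow> nat \<Rightarrow> nat \<Rightarrow> bool" where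
  "codes_embedding H B c d \<longleftrightarrow>
    (\<forall>j<card (verts H). entry c j \<in> verts H) \<and>
    (\<forall>j<card (verts H). \<forall>k<card (verts H).
      (entry c j = entry c k \<longrightarrow> j = k) \<and> (entry d j = entry d k \<longrightarrow> j = k) \<and>
      ((entry c j, entry c k) \<in> edges H \<longleftrightarrow> (entry d j, entry d k) \<in> edges B))"

text \<open>Turns embeddability of a finite graph into an unbounded search over numbers. The vertex
  list \<open>c\<close> is searched for together with the images, so that only membership, adjacency
  and cardinality of \<open>H\<close> enter the test. Entries of \<open>d\<close> are vertices of
  \<open>B\<close> automatically, as \<open>verts B = UNIV\<close>.\<close>

lemma embeds_iff_codes_embedding:
  assumes H: "finite (verts H)" and B: "verts B = UNIV"
  shows "H \<hookrightarrow>\<^sub>G B \<longleftrightarrow> (\<exists>c d. codes_embedding H B c d)"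
proof
  let ?n = "card (verts H)"
  assume "H \<hookrightarrow>\<^sub>G B"
  then obtain f where f: "embedding f H B" by (auto simp: embeds_def)
  obtain e where "bij_betw e {0..<?n} (verts H)"
    using ex_bij_betw_nat_finite[OF H] ..
  then have e: "\<And>j. j < ?n \<Longrightarrow> e j \<in> verts H" "\<And>j k. j < ?n \<Longrightarrow> k < ?n \<Longrightarrow> e j = e k \<Longrightarrow> j = k"
    by (auto simp: bij_betw_def dest: inj_onD)
  obtain c where c: "\<forall>j<?n. entry c j = e j" using entry_exists by blast
  obtain d where d: "\<forall>j<?n. entry d j = f (e j)" using entry_exists[of ?n "\<lambda>j. f (e j)"] by blast
  have "codes_embedding H B c d"
    unfolding codes_embedding_def
  proof (intro conjI allI impI)
    fix j k assume jk: "j < ?n" "k < ?n"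
    show "j = k" if "entry c j = entry c k"
      using that jk c e by simp
    show "j = k" if "entry d j = entry d k"
      using that jk d e f unfolding embedding_iff by (metis inj_onD)
    show "(entry c j, entry c k) \<in> edges H \<longleftrightarrow> (entry d j, entry d k) \<in> edges B"
      using jk c d e f unfolding embedding_iff by simp
  qed (use c e in simp)
  then show "\<exists>c d. codes_embedding H B c d" by blast
next
  let ?n = "card (verts H)"
  assume "\<exists>c d. codes_embedding H B c d"
  then obtain c d where c: "\<And>j. j < ?n \<Longrightarrow> entry c j \<in> verts H"
    and cd: "\<And>j k. j < ?n \<Longrightarrow> k < ?n \<Longrightarrow> entry c j = entry c k \<Longrightarrow> j = k"
      "\<And>j k. j < ?n \<Longrightarrow> k < ?n \<Longrightarrow> entry d j = entry d k \<Longrightarrow> j = k"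
      "\<And>j k. j < ?n \<Longrightarrow> k < ?n \<Longrightarrow>
        (entry c j, entry c k) \<in> edges H \<longleftrightarrow> (entry d j, entry d k) \<in> edges B"
    unfolding codes_embedding_def by blast
  \<comment> \<open>A list of vertices without repetition whose length is the cardinality of
    \<open>verts H\<close> contains every vertex; \<open>J\<close> will give the positions.\<close>
  have "inj_on (entry c) {..<?n}"
    using cd(1) by (intro inj_onI) auto
  then have "card (entry c ` {..<?n}) = ?n"
    by (simp add: card_image)
  moreover have "entry c ` {..<?n} \<subseteq> verts H"
    using c by auto
  ultimately have "verts H = entry c ` {..<?n}"
    using H card_subset_eq by metis
  then have "\<forall>u\<in>verts H. \<exists>j. j < ?n \<and> entry c j = u"
    by (metis imageE lessThan_iff)
  from bchoice[OF this] obtain J where J: "\<And>u. u \<in> verts H \<Longrightarrow> J u < ?n"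
    "\<And>u. u \<in> verts H \<Longrightarrow> entry c (J u) = u"
    by blast
  have "embedding (\<lambda>u. entry d (J u)) H B"
    unfolding embedding_iff
  proof (intro conjI ballI)
    show "inj_on (\<lambda>u. entry d (J u)) (verts H)"
      using J cd(2) by (intro inj_onI) metis
    show "(\<lambda>u. entry d (J u)) ` verts H \<subseteq> verts B"
      by (simp add: B)
    show "(u, v) \<in> edges H \<longleftrightarrow> (entry d (J u), entry d (J v)) \<in> edges B"
      if "u \<in> verts H" "v \<in> verts H" for u v
      using cd(3)[of "J u" "J v"] J that by simp
  qed
  then show "H \<hookrightarrow>\<^sub>G B" by (auto simp: embeds_def)
qed

text \<open>The trace is that of \<open>B\<close> itself, which is what makes the union enumerable
  from the diagram of \<open>B\<close>. Only infinity of the trace is asked for, since this suffices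
  to find fresh coding pairs.\<close>

lemma union_copy_of_same_degree:
  assumes F: "friedberg_enumeration F" and B: "verts B = UNIV" "edges B \<subseteq> verts B \<times> verts B"
    and inf: "infinite (ugraph_trace F B)"
  shows "\<exists>D. omega_ugraph D \<and> D \<cong>\<^sub>G disjoint_union (ugraph_trace F B) F \<and> deg D = deg B"
proof -
  let ?h = "char_fun (atomic_diagram B)"
  let ?I = "ugraph_trace F B"
  let ?U = "disjoint_union ?I F"
  note Fs = friedberg_enumerationD[OF F]
  define A where "A = {prod_encode (i, l) | i l. l \<in> atomic_diagram (F i)}"
  \<comment> \<open>Computability means computability from the zero oracle, and that oracle is
    recursive in every other one.\<close>
  have lift: "rec_in ?h f" if "computable_fun f" for f
    using that rec_in_trans[of "\<lambda>_. 0" f ?h] rec_in_const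
    unfolding computable_fun_def rec_in_def by blast
  have "rec_in ?h (char_fun A)"
    using F lift unfolding friedberg_enumeration_def computable_set_def A_def by blast
  then have decA: "dec_in ?h (\<lambda>x. x \<in> A)"
    by (simp add: dec_in_member)
  have "rec_in ?h (\<lambda>i. card (verts (F i)))"
    using F lift unfolding friedberg_enumeration_def by blast
  then have card: "rec_in ?h (\<lambda>x. card (verts (F (f x))))" if "rec_in ?h f" for f
    using rec_in_comp that by fast
  have decB: "dec_in ?h (\<lambda>x. x \<in> atomic_diagram B)"
    by (simp add: dec_in_member rec_in_oracle)
  \<comment> \<open>A number is a vertex exactly if the literal equating it with itself is in the
    diagram.\<close>
  have vertF: "dec_in ?h (\<lambda>x. g x \<in> verts (F (f x)))" if "rec_in ?h f" "rec_in ?h g" for f g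
  proof -
    have "dec_in ?h (\<lambda>x. prod_encode (f x, prod_encode (0, prod_encode (g x, g x))) \<in> A)"
      by (intro dec_in_comp[OF decA] rec_in_intros that)
    then show ?thesis by (simp add: A_def atomic_diagram_iff)
  qed
  have adjF: "dec_in ?h (\<lambda>x. (g x, k x) \<in> edges (F (f x)))"
    if "rec_in ?h f" "rec_in ?h g" "rec_in ?h k" for f g k
  proof -
    have "dec_in ?h (\<lambda>x. prod_encode (f x, prod_encode (2, prod_encode (g x, k x))) \<in> A)"
      by (intro dec_in_comp[OF decA] rec_in_intros that)
    moreover have "(u, v) \<in> edges (F i) \<Longrightarrow> u \<in> verts (F i) \<and> v \<in> verts (F i)" for u v i
      using Fs(1)[of i] by (auto simp: simple_ugraph_def)
    then have "prod_encode (i, prod_encode (2, prod_encode (u, v))) \<in> A \<longleftrightarrow> (u, v) \<in> edges (F i)" for u v i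
      by (auto simp: A_def atomic_diagram_iff)
    ultimately show ?thesis by simp
  qed
  have adjB: "dec_in ?h (\<lambda>x. (f x, g x) \<in> edges B)" if "rec_in ?h f" "rec_in ?h g" for f g
  proof -
    have "dec_in ?h (\<lambda>x. prod_encode (2, prod_encode (f x, g x)) \<in> atomic_diagram B)"
      by (intro dec_in_comp[OF decB] rec_in_intros that)
    then show ?thesis by (simp add: atomic_diagram_iff B)
  qed
  \<comment> \<open>Here \<open>e = <<i, u>, <c, d>>\<close>: a vertex \<open>u\<close> of
    \<open>F i\<close> together with a witness \<open>c\<close>, \<open>d\<close> that
    \<open>i\<close> is in the trace.\<close>
  define R where "R e \<longleftrightarrow> psnd (pfst e) \<in> verts (F (pfst (pfst e))) \<and>
      codes_embedding (F (pfst (pfst e))) B (pfst (psnd e)) (psnd (psnd e))" for e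
  have decR: "dec_in ?h R"
    unfolding R_def codes_embedding_def
    by (intro rec_in_intros vertF adjF adjB card rec_in_entry)
  define E where "E x y \<longleftrightarrow> pfst x = pfst y \<and> (psnd x, psnd y) \<in> edges (F (pfst x))" for x y
  have decE: "dec_in ?h (\<lambda>x. E (f x) (g x))" if "rec_in ?h f" "rec_in ?h g" for f g
    unfolding E_def by (intro rec_in_intros adjF that)
  define V where "V = prod_encode ` verts ?U"
  have V: "x \<in> V \<longleftrightarrow> prod_decode x \<in> verts ?U" for x
    by (metis V_def imageE image_eqI prod_decode_inverse prod_encode_inverse)
  have E: "E x y \<longleftrightarrow> (prod_decode x, prod_decode y) \<in> edges ?U" if "x \<in> V" for x y
    using that unfolding V E_def disjoint_union_def
    by (cases "prod_decode x"; cases "prod_decode y") auto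
  have "V = {pfst e | e. R e}"
  proof -
    have "x \<in> V \<longleftrightarrow> (\<exists>e. R e \<and> x = pfst e)" for x
    proof -
      have "x \<in> V \<longleftrightarrow> psnd x \<in> verts (F (pfst x)) \<and> (\<exists>c d. codes_embedding (F (pfst x)) B c d)"
        unfolding V disjoint_union_def ugraph_trace_def
        using embeds_iff_codes_embedding[OF Fs(2) B(1)] by (cases "prod_decode x") auto
      also have "\<dots> \<longleftrightarrow> (\<exists>c d. R (prod_encode (x, prod_encode (c, d))))"
        by (simp add: R_def)
      also have "\<dots> \<longleftrightarrow> (\<exists>e. R e \<and> x = pfst e)"
        by (metis fst_conv prod.collapse prod_decode_inverse prod_encode_inverse)
      finally show ?thesis .
    qed
    then show ?thesis by blast
  qed
  moreover have "\<exists>x\<in>V - W. \<exists>y\<in>V - W. x \<noteq> y \<and> (E x y \<longleftrightarrow> b)" if "finite W" for W b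
  proof -
    have "finite (prod_decode ` W)" using that by simp
    from union_edges_avoiding_finite[OF F inf this, of b]
    obtain x y where xy: "x \<in> verts ?U - prod_decode ` W" "y \<in> verts ?U - prod_decode ` W" "x \<noteq> y"
      "(x, y) \<in> edges ?U \<longleftrightarrow> b"
      by blast
    have x: "prod_encode x \<in> V - W" and "prod_encode y \<in> V - W"
      using xy(1,2) by (force simp: V image_iff)+
    moreover have "prod_encode x \<noteq> prod_encode y" "E (prod_encode x) (prod_encode y) \<longleftrightarrow> b"
      using xy(3,4) E[of "prod_encode x" "prod_encode y"] x by simp_all
    ultimately show ?thesis by blast
  qed
  ultimately obtain p where p: "rec_in ?h p" "bij_betw p UNIV V"
    and code: "\<And>n. E (p (3 * n)) (p (3 * n + 1)) \<longleftrightarrow> n \<in> atomic_diagram B"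
    using coding_enumeration[OF decR decE[OF rec_in_pfst[OF rec_in_id] rec_in_psnd[OF rec_in_id]] decB]
    by blast
  \<comment> \<open>Pulling back along \<open>p\<close> makes the universe all of the natural
    numbers, so that no decision procedure for \<open>V\<close> is required.\<close>
  define D where "D = \<lparr>verts = UNIV :: nat set, edges = {(x, y). E (p x) (p y)}\<rparr>"
  have "bij_betw prod_decode V (verts ?U)"
    by (rule bij_betw_byWitness[where f' = prod_encode]) (auto simp: V)
  then have "bij_betw (prod_decode \<circ> p) UNIV (verts ?U)"
    using p(2) by (blast intro: bij_betw_trans)
  moreover have "p x \<in> V" for x
    using p(2) by (auto simp: bij_betw_def)
  ultimately have "isomorphism (prod_decode \<circ> p) D ?U"
    by (simp add: isomorphism_def D_def E)
  then have iso: "D \<cong>\<^sub>G ?U" by (auto simp: isomorphic_def)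
  have "sym (edges (F i))" "irrefl (edges (F i))" for i
    using Fs(1)[of i] by (auto simp: simple_ugraph_def)
  then have "sym (edges D)" "irrefl (edges D)"
    unfolding D_def E_def sym_def irrefl_def by auto
  then have omega: "omega_ugraph D"
    by (simp add: omega_ugraph_def simple_ugraph_def D_def)
  have "atomic_diagram D \<le>\<^sub>T atomic_diagram B"
    unfolding turing_reducible_iff atomic_diagram_iff D_def
    by (simp add: case_prod_beta) (intro rec_in_intros decE rec_in_comp[OF p(1)])
  moreover have "atomic_diagram B \<le>\<^sub>T atomic_diagram D"
  proof -
    let ?g = "char_fun (atomic_diagram D)"
    have "dec_in ?g (\<lambda>x. x \<in> atomic_diagram D)"
      by (simp add: dec_in_member rec_in_oracle)
    \<comment> \<open>The tag 2 marks adjacency literals, so this asks for the bit stored at the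
      \<open>n\<close>-th coding pair.\<close>
    then have "dec_in ?g (\<lambda>n. prod_encode (2, prod_encode (3 * n, 3 * n + 1)) \<in> atomic_diagram D)"
      by (rule dec_in_comp) (intro rec_in_intros)
    then show ?thesis
      using code by (simp add: turing_reducible_iff atomic_diagram_iff D_def)
  qed
  ultimately have "deg D = deg B"
    unfolding deg_def by (rule turing_degree_cong)
  with omega iso show ?thesis by blast
qed

theorem theorem12:
  fixes F :: "nat \<Rightarrow> nat ugraph" and G S :: "nat ugraph"
  assumes "friedberg_enumeration F"
    and "omega_ugraph G"
    and "strongly_locally_finite G"
    and "open_ended G"
    and "is_skeleton F G S"
  shows "bi_embeddability_basis S G"
proof -
  let ?U = "disjoint_union (ugraph_trace F G) F"
  have G: "simple_ugraph G"
    using assms(2) by (simp add: omega_ugraph_def)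
  have S: "omega_ugraph S" "S \<cong>\<^sub>G ?U"
    using assms(5) by (auto simp: is_skeleton_def)
  have SG: "S \<approx>\<^sub>G G"
    by (rule bi_embeddable_trans[OF isomorphic_imp_bi_embeddable[OF S(2)]
          open_ended_bi_embeddable_union[OF assms(1) G assms(3,4)]])
  have "deg B \<in> DgSp_biemb G" if "omega_ugraph B" "B \<cong>\<^sub>G S" for B
    using that bi_embeddable_trans[OF isomorphic_imp_bi_embeddable[OF that(2)] SG]
    unfolding DgSp_biemb_def by blast
  moreover have "deg B \<in> DgSp_iso S" if B: "omega_ugraph B" "B \<approx>\<^sub>G G" for B
  proof -
    have BG: "B \<hookrightarrow>\<^sub>G G" "G \<hookrightarrow>\<^sub>G B"
      using B(2) by (auto simp: bi_embeddable_def)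
    have trace: "ugraph_trace F B = ugraph_trace F G"
      using ugraph_trace_mono[OF BG(1)] ugraph_trace_mono[OF BG(2)] by blast
    \<comment> \<open>An infinite structure has all natural numbers as its universe, as the
      embedding search in \<open>B\<close> requires.\<close>
    have "infinite (verts B)"
      by (rule embeds_infinite[OF BG(2) open_ended_infinite[OF assms(1) G assms(3,4)]])
    then have "verts B = UNIV" "edges B \<subseteq> verts B \<times> verts B"
      using B(1) by (auto simp: omega_ugraph_def simple_ugraph_def)
    from union_copy_of_same_degree[OF assms(1) this]
    obtain D where D: "omega_ugraph D" "D \<cong>\<^sub>G ?U" "deg D = deg B"
      using open_ended_infinite_trace[OF assms(1) G assms(3,4)] unfolding trace by blast
    have "D \<cong>\<^sub>G S"
      by (rule isomorphic_trans[OF D(2) isomorphic_sym[OF S(2)]])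
    then have "deg D \<in> DgSp_iso S"
      using D(1) unfolding DgSp_iso_def by blast
    then show ?thesis
      by (simp add: D(3))
  qed
  ultimately have "DgSp_iso S = DgSp_biemb G"
    unfolding DgSp_iso_def DgSp_biemb_def by auto
  with S(1) SG show ?thesis
    by (simp add: bi_embeddability_basis_def)
qed

end
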